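(* Let $d\ge 1$ be an integer and let $\lambda>0$. For $j=(j_1,\dots,j_d)\in\mathbb{Z}^d$ put $\omega_j=C_{d,\lambda}\prod_{k=1}^d I_{j_k}\left(\frac{1}{2\lambda}\right)$, where $C_{d,\lambda}>0$ is a constant. Let $u=(u_j)_{j\in\mathbb{Z}^d}$ be a solution on $[0,1]$ of the $d$-dimensional free discrete Schr\"odinger equation $$\partial_t u_j=i\Delta_d u_j=i\sum_{k=1}^d(u_{j+e_k}-2u_j+u_{j-e_k}),\qquad j\in\mathbb{Z}^d,$$ such that $$\sum_{j\in\mathbb{Z}^d}\frac{1}{\omega_j^2}|u_j(0)|^2+\sum_{j\in\mathbb{Z}^d}\frac{1}{\omega_j^2}|u_j(1)|^2<+\infty.$$ Then $$F(t)=\sum_{j\in\mathbb{Z}^d}\frac{1}{\omega_j^2}|u_j(t)|^2$$ is logarithmically convex in $0\le t\le 1$.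
   Context: $e_1,\dots,e_d$ is the standard basis of $\mathbb{Z}^d$. For $m\in\mathbb{Z}$ and $x>0$, $I_m(x)=\frac1\pi\int_0^\pi e^{x\cos\theta}\cos(m\theta)\,d\theta$ is the modified Bessel function of the first kind (so $I_{-m}=I_m>0$). A solution on $[0,1]$ means a complex-valued $u\in C([0,1];\ell^2(\mathbb{Z}^d))$ whose components satisfy the equation. A function $F:[0,1]\to[0,\infty)$ is logarithmically convex if $F((1-s)t_0+st_1)\le F(t_0)^{1-s}F(t_1)^s$ for all $t_0,t_1\in[0,1]$ and $s\in(0,1)$; in particular $F$ is finite on $[0,1]$. *)

theory Defs
  imports "HOL-Analysis.Analysis"
begin

text \<open>The lattice \<open>\<int>\<^sup>d\<close> is the type \<^typ>\<open>int ^ 'd\<close> with \<open>d = CARD('d) \<ge> 1\<close>;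
  its standard basis vectors are \<open>axis k 1\<close>.\<close>

definition bessel_I :: "int \<Rightarrow> real \<Rightarrow> real" where
  "bessel_I m x = 1 / pi * integral {0..pi} (\<lambda>\<theta>. exp (x * cos \<theta>) * cos (of_int m * \<theta>))"

definition bessel_weight :: "real \<Rightarrow> real \<Rightarrow> int ^ 'd \<Rightarrow> real" where
  "bessel_weight C lam j = C * (\<Prod>k\<in>UNIV. bessel_I (j $ k) (1 / (2 * lam)))"

definition discrete_laplacian :: "(int ^ 'd \<Rightarrow> complex) \<Rightarrow> int ^ 'd \<Rightarrow> complex" where
  "discrete_laplacian f j = (\<Sum>k\<in>UNIV. f (j + axis k 1) - 2 * f j + f (j - axis k 1))"

definition ell2 :: "('a \<Rightarrow> complex) set" where
  "ell2 = {f. (\<lambda>j. (cmod (f j))\<^sup>2) summable_on UNIV}"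

definition ell2_norm :: "('a \<Rightarrow> complex) \<Rightarrow> real" where
  "ell2_norm f = sqrt (\<Sum>\<^sub>\<infinity>j. (cmod (f j))\<^sup>2)"

text \<open>Membership in \<open>C(S; \<ell>\<^sup>2)\<close>. Differences of \<open>\<ell>\<^sup>2\<close> sequences are again in \<open>\<ell>\<^sup>2\<close>, so
  \<^const>\<open>ell2_norm\<close> is only applied to summable families for \<open>t \<in> S\<close>.\<close>

definition ell2_continuous_on :: "real set \<Rightarrow> (real \<Rightarrow> 'a \<Rightarrow> complex) \<Rightarrow> bool" where
  "ell2_continuous_on S u \<longleftrightarrow>
     (\<forall>t\<in>S. u t \<in> ell2) \<and>
     (\<forall>t\<in>S. ((\<lambda>s. ell2_norm (\<lambda>j. u s j - u t j)) \<longlongrightarrow> 0) (at t within S))"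

text \<open>The time derivatives at the endpoints of \<open>[0,1]\<close> are one-sided.\<close>

definition free_schroedinger_solution :: "(real \<Rightarrow> int ^ 'd \<Rightarrow> complex) \<Rightarrow> bool" where
  "free_schroedinger_solution u \<longleftrightarrow>
     ell2_continuous_on {0..1} u \<and>
     (\<forall>j. \<forall>t\<in>{0..1}. ((\<lambda>s. u s j) has_vector_derivative \<i> * discrete_laplacian (u t) j)
        (at t within {0..1}))"

definition log_convex_on :: "real set \<Rightarrow> (real \<Rightarrow> real) \<Rightarrow> bool" where
  "log_convex_on S F \<longleftrightarrow>
     (\<forall>t\<in>S. 0 \<le> F t) \<and>
     (\<forall>t0\<in>S. \<forall>t1\<in>S. \<forall>s\<in>{0<..<1}.
        F ((1 - s) * t0 + s * t1) \<le> F t0 powr (1 - s) * F t1 powr s)"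

end

theory Submission imports Defs
begin

text \<open>
  Write \<open>V = 1 / \<omega>\<close> and \<open>g = V u\<close>, so that up to a phase \<open>g' = \<i> L g\<close>, where \<open>L\<close> is the sum of the
  coordinate shifts conjugated by \<open>V\<close>, with adjoint \<open>A\<close>. If \<open>|A g| \<le> |L g|\<close> for all \<open>g\<close>, then the second
  derivative of \<open>exp (\<tau> t) |g|\<^sup>2\<close> is at least \<open>exp (\<tau> t) |L g - A g - \<i> \<tau> g|\<^sup>2 \<ge> 0\<close> for every real \<open>\<tau>\<close>,
  and convexity of \<open>exp (\<tau> t) F\<close> for all \<open>\<tau>\<close> is log-convexity of \<open>F\<close>. Contributions of distinct
  coordinate directions to \<open>|L g|\<^sup>2 - |A g|\<^sup>2\<close> cancel, so the inequality is one-dimensional. With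
  \<open>y\<^sub>n = I\<^sub>n / I\<^sub>n\<^sub>+\<^sub>1\<close> and \<open>c\<^sub>n = y\<^sub>n / y\<^sub>n\<^sub>-\<^sub>1 - y\<^sub>n\<^sub>-\<^sub>1 / y\<^sub>n\<close> it follows from
  \<open>c\<^sub>n\<^sub>+\<^sub>1 + c\<^sub>n\<^sub>-\<^sub>1 \<le> c\<^sub>n (y\<^sub>n y\<^sub>n\<^sub>-\<^sub>1 + 1 / (y\<^sub>n y\<^sub>n\<^sub>-\<^sub>1))\<close>, which reduces, by the three-term recurrence, to a lower
  bound for \<open>y\<^sub>n\<close> that comes from its Riccati equation.

  For the weight itself \<open>L\<close> is unbounded. The ratios \<open>y\<^sub>n\<close> are therefore changed for large \<open>n\<close> into a bounded
  sequence that satisfies the same inequality. The new weight grows only exponentially, while \<open>u\<close>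
  decays faster than any exponential uniformly in time, so all sums can be differentiated termwise;
  the new weights lie below \<open>V\<close> and agree with it on large boxes.\<close>

section \<open>Modified Bessel functions\<close>

lemma bessel_I_uminus: "bessel_I (- m) x = bessel_I m x"
  by (simp add: bessel_I_def)

text \<open>Integrate the derivative of
  \<open>2 * exp (x * cos \<theta>) * sin (m * \<theta>)\<close> over \<open>[0, pi]\<close>. The
  boundary terms vanish because \<open>m\<close> is an integer.\<close>

lemma bessel_I_recurrence:
  "x * (bessel_I (m - 1) x - bessel_I (m + 1) x) = 2 * of_int m * bessel_I m x"
proof -
  define f where "f k \<theta> = exp (x * cos \<theta>) * cos (of_int k * \<theta>)" for k :: int and \<theta> :: real
  have int_f: "f k integrable_on {0..pi}" for k
    unfolding f_def by (intro integrable_continuous_interval continuous_intros)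
  have trig: "cos (of_int (m - 1) * \<theta>) - cos (of_int (m + 1) * \<theta>) = 2 * sin \<theta> * sin (of_int m * \<theta>)"
    for \<theta> :: real
    by (simp add: algebra_simps cos_add cos_diff)
  have "((\<lambda>\<theta>. 2 * of_int m * f m \<theta> - x * (f (m - 1) \<theta> - f (m + 1) \<theta>)) has_integral
      (2 * (exp (x * cos pi) * sin (of_int m * pi)) - 2 * (exp (x * cos 0) * sin (of_int m * 0)))) {0..pi}"
  proof (rule fundamental_theorem_of_calculus)
    fix \<theta> :: real
    have eq: "2 * of_int m * f m \<theta> - x * (f (m - 1) \<theta> - f (m + 1) \<theta>)
        = 2 * (exp (x * cos \<theta>) * (x * - sin \<theta>) * sin (of_int m * \<theta>)
             + exp (x * cos \<theta>) * (cos (of_int m * \<theta>) * of_int m))"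
      unfolding f_def right_diff_distrib[symmetric] trig by (simp add: algebra_simps)
    show "((\<lambda>\<theta>. 2 * (exp (x * cos \<theta>) * sin (of_int m * \<theta>))) has_vector_derivative
        2 * of_int m * f m \<theta> - x * (f (m - 1) \<theta> - f (m + 1) \<theta>)) (at \<theta> within {0..pi})"
      unfolding eq has_real_derivative_iff_has_vector_derivative[symmetric]
      by (auto intro!: derivative_eq_intros simp: algebra_simps)
  qed simp
  then have "((\<lambda>\<theta>. 2 * of_int m * f m \<theta> - x * (f (m - 1) \<theta> - f (m + 1) \<theta>)) has_integral 0) {0..pi}"
    using sin_npi_int[of m] by (simp add: mult.commute)
  moreover have "((\<lambda>\<theta>. 2 * of_int m * f m \<theta> - x * (f (m - 1) \<theta> - f (m + 1) \<theta>)) has_integral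
      2 * of_int m * integral {0..pi} (f m)
        - x * (integral {0..pi} (f (m - 1)) - integral {0..pi} (f (m + 1)))) {0..pi}"
    by (intro has_integral_diff has_integral_mult_right integrable_integral int_f)
  ultimately have "2 * of_int m * integral {0..pi} (f m)
        - x * (integral {0..pi} (f (m - 1)) - integral {0..pi} (f (m + 1))) = 0"
    by (rule has_integral_unique[symmetric])
  then show ?thesis
    unfolding bessel_I_def f_def by (simp add: field_simps)
qed

text \<open>Differentiation under the integral sign produces a factor \<open>cos \<theta>\<close>,
  which the product-to-sum formula turns into a shift of the index by one in both
  directions.\<close>

lemma DERIV_bessel_I:
  "(bessel_I m has_real_derivative (bessel_I (m - 1) x + bessel_I (m + 1) x) / 2) (at x)"
proof -
  define f where "f x k \<theta> = exp (x * cos \<theta>) * cos (of_int k * \<theta>)" for k :: int and x \<theta> :: real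
  have int_f: "f x k integrable_on {0..pi}" for x k
    unfolding f_def by (intro integrable_continuous_interval continuous_intros)
  have trig: "2 * cos \<theta> * cos (of_int m * \<theta>) = cos (of_int (m - 1) * \<theta>) + cos (of_int (m + 1) * \<theta>)"
    for \<theta> :: real
    by (simp add: algebra_simps cos_add cos_diff)
  have eq: "cos \<theta> * f x m \<theta> = (f x (m - 1) \<theta> + f x (m + 1) \<theta>) / 2" for x \<theta>
    unfolding f_def distrib_left[symmetric] trig[symmetric] by simp
  have "((\<lambda>x. integral (cbox 0 pi) (f x m)) has_field_derivative
      integral (cbox 0 pi) (\<lambda>\<theta>. cos \<theta> * f x m \<theta>)) (at x within UNIV)"
  proof (rule leibniz_rule_field_derivative)
    show "((\<lambda>x. f x m t) has_field_derivative cos t * f x m t) (at x within UNIV)" for x t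
      unfolding f_def by (auto intro!: derivative_eq_intros)
    show "f x m integrable_on cbox 0 pi" for x
      using int_f by simp
    show "continuous_on (UNIV \<times> cbox 0 pi) (\<lambda>(x, t). cos t * f x m t)"
      unfolding f_def case_prod_beta by (intro continuous_intros)
  qed auto
  then have "((\<lambda>x. 1 / pi * integral {0..pi} (f x m)) has_field_derivative
      1 / pi * integral {0..pi} (\<lambda>\<theta>. (f x (m - 1) \<theta> + f x (m + 1) \<theta>) / 2)) (at x)"
    unfolding eq by (intro DERIV_cmult) simp
  also have "integral {0..pi} (\<lambda>\<theta>. (f x (m - 1) \<theta> + f x (m + 1) \<theta>) / 2)
      = (integral {0..pi} (f x (m - 1)) + integral {0..pi} (f x (m + 1))) / 2"
    by (simp add: integral_add int_f)
  finally show ?thesis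
    unfolding bessel_I_def f_def by (simp add: field_simps)
qed

text \<open>The integral in Poisson's representation of the Bessel function, without its prefactor.
  Its integrand is nonnegative, whereas the one in \<open>bessel_I\<close> oscillates, so positivity
  is visible here.\<close>

definition poisson_integral :: "nat \<Rightarrow> real \<Rightarrow> real" where
  "poisson_integral m x = integral {0..pi} (\<lambda>\<theta>. sin \<theta> ^ (2 * m) * exp (x * cos \<theta>))"

lemma poisson_integral_pos: "poisson_integral m x > 0"
proof -
  have cont: "continuous_on {0..pi} (\<lambda>\<theta>. sin \<theta> ^ (2 * m) * exp (x * cos \<theta>))"
    by (intro continuous_intros)
  have nonneg: "0 \<le> sin \<theta> ^ (2 * m) * exp (x * cos \<theta>)" for \<theta> :: real
    by simp
  have "poisson_integral m x \<ge> 0"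
    unfolding poisson_integral_def by (intro integral_nonneg integrable_continuous_interval cont nonneg)
  moreover have "poisson_integral m x \<noteq> 0"
  proof
    assume "poisson_integral m x = 0"
    then have "((\<lambda>\<theta>. sin \<theta> ^ (2 * m) * exp (x * cos \<theta>)) has_integral 0) (cbox 0 pi)"
      unfolding poisson_integral_def
      using integrable_continuous_interval[OF cont] by (simp add: has_integral_integral)
    \<comment> \<open>A continuous nonnegative function with integral 0 vanishes identically; at
      \<open>pi / 2\<close> the integrand is 1.\<close>
    then have "sin (pi / 2) ^ (2 * m) * exp (x * cos (pi / 2)) = 0"
      by (rule has_integral_0_cbox_imp_0[rotated 2])
        (use cont nonneg pi_gt_zero in \<open>auto simp: box_real not_le\<close>)
    then show False by simp
  qed
  ultimately show ?thesis by simp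
qed

lemma DERIV_sin_power_Suc:
  "((\<lambda>\<theta>. sin \<theta> ^ Suc n) has_real_derivative (real n + 1) * sin \<theta> ^ n * cos \<theta>) (at \<theta> within S)"
  by (rule DERIV_cong[OF DERIV_power_Suc]) (auto intro!: derivative_eq_intros)

text \<open>Integration by parts: the function
  \<open>sin \<theta> ^ (2 * m + 1) * exp (x * cos \<theta>)\<close> vanishes at both
  endpoints.\<close>

lemma poisson_integral_cos:
  "(2 * real m + 1) * integral {0..pi} (\<lambda>\<theta>. sin \<theta> ^ (2 * m) * exp (x * cos \<theta>) * cos \<theta>)
    = x * poisson_integral (Suc m) x"
proof -
  have "((\<lambda>\<theta>. (2 * real m + 1) * (sin \<theta> ^ (2 * m) * exp (x * cos \<theta>) * cos \<theta>)
        - x * (sin \<theta> ^ (2 * Suc m) * exp (x * cos \<theta>))) has_integral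
      sin pi ^ Suc (2 * m) * exp (x * cos pi) - sin 0 ^ Suc (2 * m) * exp (x * cos 0)) {0..pi}"
  proof (rule fundamental_theorem_of_calculus)
    fix \<theta> :: real
    have e: "((\<lambda>\<theta>. exp (x * cos \<theta>)) has_real_derivative - x * sin \<theta> * exp (x * cos \<theta>)) (at \<theta> within {0..pi})"
      by (auto intro!: derivative_eq_intros)
    show "((\<lambda>\<theta>. sin \<theta> ^ Suc (2 * m) * exp (x * cos \<theta>)) has_vector_derivative
        (2 * real m + 1) * (sin \<theta> ^ (2 * m) * exp (x * cos \<theta>) * cos \<theta>)
        - x * (sin \<theta> ^ (2 * Suc m) * exp (x * cos \<theta>))) (at \<theta> within {0..pi})"
      unfolding has_real_derivative_iff_has_vector_derivative[symmetric]
      by (rule DERIV_cong[OF DERIV_mult[OF DERIV_sin_power_Suc e]]) (simp add: algebra_simps)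
  qed simp
  then have "integral {0..pi} (\<lambda>\<theta>. (2 * real m + 1) * (sin \<theta> ^ (2 * m) * exp (x * cos \<theta>) * cos \<theta>)
        - x * (sin \<theta> ^ (2 * Suc m) * exp (x * cos \<theta>))) = 0"
    by (simp add: integral_unique)
  then show ?thesis
    unfolding poisson_integral_def
    by (subst (asm) integral_diff)
      (auto intro!: integrable_continuous_interval continuous_intros)
qed

text \<open>The counterpart of the three-term recurrence. Integrating the derivative of \<open>sin
  \<theta> ^ (2 * m - 1) * cos \<theta> * exp (x * cos \<theta>)\<close> leaves an integral with an
  extra \<open>cos \<theta>\<close>, which \<open>poisson_integral_cos\<close> converts to index
  \<open>m + 1\<close>.\<close>

lemma poisson_integral_Suc:
  assumes "m > 0"
  shows "(2 * real m - 1) * poisson_integral (m - 1) x - 2 * real m * poisson_integral m x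
    = x\<^sup>2 * poisson_integral (Suc m) x / (2 * real m + 1)"
proof -
  define B where "B = integral {0..pi} (\<lambda>\<theta>. sin \<theta> ^ (2 * m) * exp (x * cos \<theta>) * cos \<theta>)"
  obtain k where k: "m = Suc k" using assms gr0_conv_Suc by blast
  have "((\<lambda>\<theta>. (2 * real m - 1) * (sin \<theta> ^ (2 * k) * exp (x * cos \<theta>))
        - 2 * real m * (sin \<theta> ^ (2 * m) * exp (x * cos \<theta>))
        - x * (sin \<theta> ^ (2 * m) * exp (x * cos \<theta>) * cos \<theta>)) has_integral
      sin pi ^ Suc (2 * k) * (cos pi * exp (x * cos pi)) - sin 0 ^ Suc (2 * k) * (cos 0 * exp (x * cos 0))) {0..pi}"
  proof (rule fundamental_theorem_of_calculus)
    fix \<theta> :: real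
    have c: "cos \<theta> * cos \<theta> = 1 - sin \<theta> * sin \<theta>"
      using sin_cos_squared_add3[of \<theta>] by linarith
    have eq: "(2 * real m - 1) * (sin \<theta> ^ (2 * k) * exp (x * cos \<theta>))
        - 2 * real m * (sin \<theta> ^ (2 * m) * exp (x * cos \<theta>))
        - x * (sin \<theta> ^ (2 * m) * exp (x * cos \<theta>) * cos \<theta>)
      = exp (x * cos \<theta>) * sin \<theta> ^ (2 * k) * ((2 * real k + 1) * (cos \<theta> * cos \<theta>)
          - sin \<theta> * sin \<theta> - x * (sin \<theta> * sin \<theta>) * cos \<theta>)"
      unfolding c by (simp add: k algebra_simps)
    have e: "((\<lambda>\<theta>. cos \<theta> * exp (x * cos \<theta>)) has_real_derivative
        - sin \<theta> * exp (x * cos \<theta>) - x * sin \<theta> * cos \<theta> * exp (x * cos \<theta>)) (at \<theta> within {0..pi})"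
      by (auto intro!: derivative_eq_intros simp: algebra_simps)
    show "((\<lambda>\<theta>. sin \<theta> ^ Suc (2 * k) * (cos \<theta> * exp (x * cos \<theta>))) has_vector_derivative
      (2 * real m - 1) * (sin \<theta> ^ (2 * k) * exp (x * cos \<theta>))
        - 2 * real m * (sin \<theta> ^ (2 * m) * exp (x * cos \<theta>))
        - x * (sin \<theta> ^ (2 * m) * exp (x * cos \<theta>) * cos \<theta>)) (at \<theta> within {0..pi})"
      unfolding has_real_derivative_iff_has_vector_derivative[symmetric] eq
      by (rule DERIV_cong[OF DERIV_mult[OF DERIV_sin_power_Suc e]]) (simp add: algebra_simps)
  qed simp
  then have "integral {0..pi} (\<lambda>\<theta>. (2 * real m - 1) * (sin \<theta> ^ (2 * k) * exp (x * cos \<theta>))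
        - 2 * real m * (sin \<theta> ^ (2 * m) * exp (x * cos \<theta>))
        - x * (sin \<theta> ^ (2 * m) * exp (x * cos \<theta>) * cos \<theta>)) = 0"
    by (simp add: integral_unique)
  then have "(2 * real m - 1) * poisson_integral (m - 1) x - 2 * real m * poisson_integral m x = x * B"
    unfolding poisson_integral_def B_def
    by (subst (asm) integral_diff, (intro integrable_continuous_interval continuous_intros)+,
        subst (asm) integral_diff) 
      (auto intro!: integrable_continuous_interval continuous_intros simp: k)
  moreover have "B = x * poisson_integral (Suc m) x / (2 * real m + 1)"
    using poisson_integral_cos[of m x] by (simp add: B_def field_simps)
  ultimately show ?thesis by (simp add: power2_eq_square)
qed

text \<open>The recurrence is of second order, so the induction carries two consecutive indices. The
  explicit quotient \<open>b / a\<close> is what makes the two recurrences match in the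
  step.\<close>

lemma bessel_I_poisson:
  assumes "x > 0"
  shows "\<exists>a > 0. \<exists>b > 0. bessel_I (int m) x = a * poisson_integral m x \<and>
    bessel_I (int (Suc m)) x = b * poisson_integral (Suc m) x \<and> b = a * x / (2 * real m + 1)"
proof (induction m)
  case 0
  show ?case
    using assms poisson_integral_cos[of 0 x]
    by (intro exI[of _ "1 / pi"] conjI exI[of _ "x / pi"])
      (auto simp: bessel_I_def poisson_integral_def)
next
  case (Suc m)
  then obtain a b where ab: "a > 0" "b > 0" "bessel_I (int m) x = a * poisson_integral m x"
    "bessel_I (int (Suc m)) x = b * poisson_integral (Suc m) x" "b = a * x / (2 * real m + 1)"
    by blast
  define c where "c = b * x / (2 * real (Suc m) + 1)"
  have "x * (bessel_I (int m) x - bessel_I (int (Suc (Suc m))) x)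
      = 2 * real (Suc m) * bessel_I (int (Suc m)) x"
    using bessel_I_recurrence[of x "int (Suc m)"] by (simp add: algebra_simps)
  then have "x * bessel_I (int (Suc (Suc m))) x
      = x * a * poisson_integral m x - 2 * real (Suc m) * b * poisson_integral (Suc m) x"
    unfolding ab(3,4) by (simp add: algebra_simps)
  also have "x * a = (2 * real m + 1) * b"
    using ab(5) by (simp add: field_simps)
  also have "(2 * real m + 1) * b * poisson_integral m x - 2 * real (Suc m) * b * poisson_integral (Suc m) x
      = b * ((2 * real (Suc m) - 1) * poisson_integral (Suc m - 1) x - 2 * real (Suc m) * poisson_integral (Suc m) x)"
    by (simp add: algebra_simps)
  also have "\<dots> = x * (c * poisson_integral (Suc (Suc m)) x)"
    by (subst poisson_integral_Suc) (simp_all add: c_def power2_eq_square)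
  finally have "bessel_I (int (Suc (Suc m))) x = c * poisson_integral (Suc (Suc m)) x"
    using assms by simp
  moreover have "c > 0" using ab assms by (simp add: c_def)
  ultimately show ?case
    using ab c_def by blast
qed

lemma bessel_I_pos:
  assumes "x > 0"
  shows "bessel_I m x > 0"
proof -
  have "bessel_I (int k) x > 0" for k
    using bessel_I_poisson[OF assms, of k] poisson_integral_pos[of k x] by auto
  moreover have "bessel_I m x = bessel_I (int (nat \<bar>m\<bar>)) x"
    by (cases "m \<ge> 0") (simp_all add: bessel_I_uminus)
  ultimately show ?thesis by metis
qed

section \<open>Sequences of ratios\<close>

text \<open>These are the numbers \<open>c\<close> of the introduction. The value at 0 is the
  general formula with 1 / \<open>y 0\<close> in place of the ratio at index -1, which expresses
  that the weight is even.\<close>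

definition turan_gap :: "(nat \<Rightarrow> real) \<Rightarrow> nat \<Rightarrow> real" where
  "turan_gap y n = (case n of 0 \<Rightarrow> (y 0)\<^sup>2 - 1 / (y 0)\<^sup>2
     | Suc k \<Rightarrow> y (Suc k) / y k - y k / y (Suc k))"

text \<open>The right-hand side is the product of \<open>turan_gap y (Suc n)\<close> with
  \<open>y n * y (Suc n) + 1 / (y n * y (Suc n))\<close>, multiplied out. At the origin both
  neighbours have the same gap and the second factor is 2, so a factor 2 cancels.\<close>

definition gap_condition :: "(nat \<Rightarrow> real) \<Rightarrow> bool" where
  "gap_condition y \<longleftrightarrow> (\<forall>n. y n > 0) \<and> turan_gap y 1 \<le> turan_gap y 0 \<and>
     (\<forall>n. turan_gap y (Suc (Suc n)) + turan_gap y n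
        \<le> (y (Suc n))\<^sup>2 - 1 / (y (Suc n))\<^sup>2 + 1 / (y n)\<^sup>2 - (y n)\<^sup>2)"

section \<open>The rational inequality for the extremal ratios\<close>

lemma inverse_minus_antimono:
  fixes a b :: real
  assumes "0 < a" "a \<le> b"
  shows "1 / b - b \<le> 1 / a - a"
  using assms frac_le[of 1 1 a b] by simp

text \<open>In the variables \<open>E - 1\<close> and \<open>j - 1\<close>, both nonnegative, the
  polynomial has only nonnegative coefficients. The form of the expression comes from clearing
  denominators in \<open>gap_rational_inequality\<close>.\<close>

lemma gap_polynomial_nonneg:
  fixes E j :: real
  assumes "E \<ge> 1" "j \<ge> 1"
  defines "A \<equiv> j * (E + 1) + E" and "B \<equiv> j * (E + 1) + 1"
  defines "N \<equiv> A\<^sup>2 + (j - 1) * (E\<^sup>2 - 1) * B"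
  shows "0 \<le> E^2 * A^2 * B^2 * N - E^2 * B^4 * N + A^4 * N - A^2 * B^2 * N
    - E * (A^3 * B - A * B^3) * N - E^2 * A^2 * B^4 + A^2 * N^2" (is "0 \<le> ?G")
proof -
  define e i where "e = E - 1" and "i = j - 1"
  then have ei: "e \<ge> 0" "i \<ge> 0" "E = 1 + e" "j = 1 + i"
    using assms by auto
  have "?G = e^3 * ((108 + 540 * i^1 + 1008 * i^2 + 896 * i^3 + 384 * i^4 + 64 * i^5)
    + e^1 * (306 + 1614 * i^1 + 3148 * i^2 + 2912 * i^3 + 1296 * i^4 + 224 * i^5)
    + e^2 * (354 + 1958 * i^1 + 3980 * i^2 + 3832 * i^3 + 1776 * i^4 + 320 * i^5)
    + e^3 * (210 + 1221 * i^1 + 2599 * i^2 + 2620 * i^3 + 1272 * i^4 + 240 * i^5)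
    + e^4 * (64 + 403 * i^1 + 917 * i^2 + 982 * i^3 + 504 * i^4 + 100 * i^5)
    + e^5 * (8 + 63 * i^1 + 163 * i^2 + 191 * i^3 + 105 * i^4 + 22 * i^5)
    + e^6 * (3 * i^1 + 11 * i^2 + 15 * i^3 + 9 * i^4 + 2 * i^5))"
    unfolding N_def A_def B_def ei(3,4) by algebra
  also have "\<dots> \<ge> 0"
    using ei(1,2) by (intro mult_nonneg_nonneg add_nonneg_nonneg zero_le_power) auto
  finally show ?thesis .
qed

text \<open>The extremal case of the gap condition at an index \<open>j\<close>, with
  \<open>E\<close> the square of the ratio there: \<open>A / B - B / A\<close> and
  \<open>1 / Y - Y\<close> are the bounds for the gaps at \<open>j + 1\<close> and
  \<open>j - 1\<close>, and \<open>A\<^sup>2 / (E * B\<^sup>2)\<close> replaces the inverse square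
  of the preceding ratio. Multiplication by the common denominator \<open>D\<close> gives the
  polynomial above.\<close>

lemma gap_rational_inequality:
  fixes E j :: real
  assumes "E \<ge> 1" "j \<ge> 1"
  defines "A \<equiv> j * (E + 1) + E" and "B \<equiv> j * (E + 1) + 1"
  defines "Y \<equiv> A\<^sup>2 / (E * B\<^sup>2) + (j - 1) * (E\<^sup>2 - 1) / (E * B)"
  shows "(A / B - B / A) + (1 / Y - Y) \<le> E - 1 / E + A\<^sup>2 / (E * B\<^sup>2) - E * B\<^sup>2 / A\<^sup>2"
proof -
  define N where "N = A\<^sup>2 + (j - 1) * (E\<^sup>2 - 1) * B"
  have pos: "A > 0" "B > 0" "E > 0"
    using assms by (auto simp: add_nonneg_pos)
  have E2: "E\<^sup>2 \<ge> 1" using assms by simp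
  have N: "N > 0"
    unfolding N_def using pos assms(2) E2 by (intro add_pos_nonneg mult_nonneg_nonneg) auto
  have Y: "Y = N / (E * B\<^sup>2)"
    using pos by (simp add: Y_def N_def field_simps power2_eq_square)
  define D where "D = E * A\<^sup>2 * B\<^sup>2 * N"
  have D: "D > 0" using pos N by (simp add: D_def)
  have "D * E = E^2 * A^2 * B^2 * N" "D * (1 / E) = A^2 * B^2 * N"
    "D * (A\<^sup>2 / (E * B\<^sup>2)) = A^4 * N" "D * (E * B\<^sup>2 / A\<^sup>2) = E^2 * B^4 * N"
    "D * (A / B) = E * (A^3 * B) * N" "D * (B / A) = E * (A * B^3) * N"
    "D * (1 / Y) = E^2 * A^2 * B^4" "D * Y = A^2 * N^2"
    using pos N unfolding D_def Y by (simp_all add: power2_eq_square power3_eq_cube power4_eq_xxxx)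
  then have "D * (E - 1 / E + A\<^sup>2 / (E * B\<^sup>2) - E * B\<^sup>2 / A\<^sup>2 - ((A / B - B / A) + (1 / Y - Y)))
    = E^2 * A^2 * B^2 * N - E^2 * B^4 * N + A^4 * N - A^2 * B^2 * N
    - E * (A^3 * B - A * B^3) * N - E^2 * A^2 * B^4 + A^2 * N^2"
    unfolding right_diff_distrib distrib_left left_diff_distrib by linarith
  also have "\<dots> \<ge> 0"
    using gap_polynomial_nonneg[OF assms(1,2)] unfolding A_def B_def N_def .
  finally show ?thesis using D by (simp add: zero_le_mult_iff)
qed

text \<open>In the application \<open>y n = I\<^sub>n(x) / I\<^sub>n\<^sub>+\<^sub>1(x)\<close> and \<open>w = 1 / x\<close>; the last assumption says
  \<open>x (y\<^sub>n - 1 / y\<^sub>n) \<ge> 2 n + 1 + tanh (ln y\<^sub>n)\<close>.\<close>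

locale ratio_sequence =
  fixes y :: "nat \<Rightarrow> real" and w :: real
  assumes w_pos: "w > 0"
    and y_pos: "y n > 0"
    and rec: "y n = 2 * (real n + 1) * w + 1 / y (Suc n)"
    and y_ge_1: "y n \<ge> 1"
    and lower: "w * (2 * real n + 2 * (y n)\<^sup>2 / ((y n)\<^sup>2 + 1)) \<le> y n - 1 / y n"
begin

context
  fixes n :: nat and E A B :: real
  defines "E \<equiv> (y n)\<^sup>2" and "A \<equiv> real n * (E + 1) + E" and "B \<equiv> real n * (E + 1) + 1"
begin

lemma E_ge_1: "E \<ge> 1"
  unfolding E_def using y_ge_1[of n] by simp

lemma A_pos: "A > 0" and B_pos: "B > 0" and B_le_A: "B \<le> A"
  using E_ge_1 by (auto simp: A_def B_def add_nonneg_pos)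

text \<open>The assumption \<open>lower\<close> with the denominator \<open>E + 1\<close> cleared,
  which is where \<open>A\<close> comes from. It is used as an upper bound for
  \<open>w\<close>.\<close>

lemma lower': "2 * w * y n * A \<le> E\<^sup>2 - 1"
proof -
  have "w * (2 * real n + 2 * E / (E + 1)) * (y n * (E + 1)) \<le> (y n - 1 / y n) * (y n * (E + 1))"
    using lower[of n] y_pos[of n] E_ge_1 by (intro mult_right_mono) (auto simp: E_def)
  moreover have "w * (2 * real n + 2 * E / (E + 1)) * (y n * (E + 1)) = 2 * w * y n * A"
  proof -
    have "(2 * real n + 2 * E / (E + 1)) * (E + 1) = 2 * A"
      using E_ge_1 by (simp add: A_def field_simps)
    then show ?thesis by (metis (no_types, opaque_lifting) mult.assoc mult.commute)
  qed
  moreover have "(y n - 1 / y n) * (y n * (E + 1)) = E\<^sup>2 - 1"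
    using y_pos[of n] by (simp add: E_def field_simps power2_eq_square)
  ultimately show ?thesis by simp
qed

text \<open>By the recurrence the quotient is affine and decreasing in \<open>w\<close> when
  \<open>y n\<close> is held fixed. Inserting the bound \<open>lower'\<close> for \<open>w\<close>
  yields exactly \<open>B / A\<close>.\<close>

lemma next_ratio: "B / A \<le> y n / y (Suc n)"
proof -
  have "y n / y (Suc n) = E - 2 * (real n + 1) * w * y n"
  proof -
    have "1 / y (Suc n) = y n - 2 * (real n + 1) * w" using rec[of n] by simp
    then have "y n * (1 / y (Suc n)) = y n * (y n - 2 * (real n + 1) * w)" by simp
    then show ?thesis by (simp add: E_def algebra_simps power2_eq_square)
  qed
  moreover have "(real n + 1) * (2 * w * y n * A) \<le> (real n + 1) * (E\<^sup>2 - 1)"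
    using lower' by (intro mult_left_mono) auto
  then have "2 * (real n + 1) * w * y n \<le> (real n + 1) * (E\<^sup>2 - 1) / A"
    using A_pos by (simp add: field_simps)
  moreover have "E - (real n + 1) * (E\<^sup>2 - 1) / A = B / A"
    using A_pos by (simp add: field_simps) (simp add: A_def B_def algebra_simps power2_eq_square)
  ultimately show ?thesis by linarith
qed

lemma gap_next: "turan_gap y (Suc n) \<le> A / B - B / A"
  using inverse_minus_antimono[OF _ next_ratio] A_pos B_pos by (simp add: turan_gap_def)

end

text \<open>The same argument one index down: the recurrence makes \<open>y n * y m\<close> affine
  and increasing in \<open>w\<close> for fixed \<open>y m\<close>, and the largest value permitted
  by \<open>lower'\<close> gives \<open>B / A\<close> as a bound for
  \<open>y n / y m\<close>.\<close>

lemma prev_ratio: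
  fixes n :: nat
  defines "m \<equiv> Suc n"
  defines "E \<equiv> (y m)\<^sup>2"
  defines "A \<equiv> real m * (E + 1) + E" and "B \<equiv> real m * (E + 1) + 1"
  shows "y n * A \<le> y m * B"
proof -
  have A: "A > 0" "E > 0"
    using A_pos[of m] E_ge_1[of m] by (auto simp: A_def E_def)
  have l: "2 * w * y m * A \<le> E\<^sup>2 - 1"
    using lower'[of m] by (simp add: A_def E_def)
  have "real m * (2 * w * y m * A) \<le> real m * (E\<^sup>2 - 1)"
    by (intro mult_left_mono l) simp
  moreover have "y n * y m = 2 * real m * w * y m + 1"
    using rec[of n] y_pos[of m] by (simp add: m_def field_simps)
  then have "y n * y m * A = real m * (2 * w * y m * A) + A"
    by (simp add: algebra_simps)
  ultimately have "y n * y m * A \<le> real m * (E\<^sup>2 - 1) + A"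
    by simp
  also have "\<dots> = y m * y m * B"
    by (simp add: A_def B_def E_def algebra_simps power2_eq_square)
  finally show ?thesis
    using y_pos[of m] by (simp add: mult.commute mult.left_commute)
qed

lemma y_mono: "y n \<le> y (Suc n)"
proof -
  define E where "E = (y (Suc n))\<^sup>2"
  define A B where "A = real (Suc n) * (E + 1) + E" and "B = real (Suc n) * (E + 1) + 1"
  have "y n * A \<le> y (Suc n) * B"
    using prev_ratio[of n] by (simp add: A_def B_def E_def)
  also have "\<dots> \<le> y (Suc n) * A"
    using E_ge_1[of "Suc n"] y_pos[of "Suc n"] by (intro mult_left_mono) (auto simp: A_def B_def E_def)
  finally show ?thesis
    using A_pos[of "Suc n"] by (simp add: A_def E_def)
qed

text \<open>For fixed \<open>y\<^sub>n\<^sub>+\<^sub>1\<close> the two sides are monotone in \<open>w\<close> in opposite directions, so it suffices to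
  treat the largest \<open>w\<close> that the assumption \<open>lower\<close> permits.\<close>

lemma gap_condition: "gap_condition y"
proof -
  \<comment> \<open>At index 0, \<open>A = E\<close> and \<open>B = 1\<close>, so the bound from
    \<open>gap_next\<close> is already \<open>turan_gap y 0\<close>.\<close>
  have 0: "turan_gap y 1 \<le> turan_gap y 0"
    using gap_next[of 0] by (simp add: turan_gap_def)
  have "turan_gap y (Suc (Suc n)) + turan_gap y n
      \<le> (y (Suc n))\<^sup>2 - 1 / (y (Suc n))\<^sup>2 + 1 / (y n)\<^sup>2 - (y n)\<^sup>2" for n
  proof -
    define m where "m = Suc n"
    define E where "E = (y m)\<^sup>2"
    define A B where "A = real m * (E + 1) + E" and "B = real m * (E + 1) + 1"
    \<comment> \<open>\<open>t0\<close> is the lower bound that \<open>prev_ratio\<close> gives for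
      \<open>t\<close>. The factor \<open>k\<close> appears when \<open>w\<close> is eliminated
      through the recurrence, and \<open>Y\<close> below is the value of \<open>r\<close> at
      \<open>t = t0\<close>.\<close>
    define t t0 k where "t = 1 / y n" and "t0 = A / (y m * B)" and "k = (real m - 1) / real m"
    define Y where "Y = A\<^sup>2 / (E * B\<^sup>2) + (real m - 1) * (E\<^sup>2 - 1) / (E * B)"
    have E: "E \<ge> 1" "E = y m * y m" using E_ge_1[of m] by (auto simp: E_def power2_eq_square)
    have AB: "A > 0" "B > 0" "B \<le> A"
      using A_pos[of m] B_pos[of m] B_le_A[of m] by (auto simp: A_def B_def E_def)
    note ym = y_pos[of m] and yn = y_pos[of n]
    have m1: "real m \<ge> 1" by (simp add: m_def)
    have k: "0 \<le> k" "k \<le> 1" using m1 by (auto simp: k_def)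
    have Q: "y n * A \<le> y m * B"
      using prev_ratio[of n] by (simp add: A_def B_def E_def m_def)
    have t_ge: "t0 \<le> t"
      using Q yn ym AB by (simp add: t_def t0_def field_simps)
    have t0_ge: "1 / y m \<le> t0"
      using ym AB by (simp add: t0_def field_simps)
    have w_eq: "2 * w = (y n - 1 / y m) / real m"
      using rec[of n] by (simp add: m_def field_simps)
    \<comment> \<open>By the recurrence \<open>r\<close> is the quotient of the ratios at
      \<open>m - 2\<close> and \<open>m - 1\<close>. For \<open>m = 1\<close> it is
      \<open>t\<^sup>2\<close>, in agreement with the value of \<open>turan_gap\<close> at
      0.\<close>
    define r where "r = (2 * (real m - 1) * w + t) * t"
    have r_eq: "r = t\<^sup>2 + k * (1 - t / y m)"
    proof -
      have "2 * (real m - 1) * w = (real m - 1) * (2 * w)" by simp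
      also have "\<dots> = k * (y n - 1 / y m)"
        unfolding w_eq k_def by simp
      finally have "r = (k * (y n - 1 / y m) + t) * t"
        by (simp add: r_def)
      then show ?thesis
        using yn by (simp add: t_def field_simps power2_eq_square)
    qed
    have Y_eq: "Y = t0\<^sup>2 + k * (1 - t0 / y m)"
    proof -
      have "E * B - A = real m * (E\<^sup>2 - 1)"
        by (simp add: A_def B_def algebra_simps power2_eq_square)
      then have "1 - t0 / y m = real m * (E\<^sup>2 - 1) / (E * B)"
        using ym AB E by (simp add: t0_def field_simps)
      then show ?thesis
        using m1 by (simp add: Y_def k_def t0_def power_divide power_mult_distrib E_def)
    qed
    have "k / y m \<le> 1 / y m"
      using k ym by (intro divide_right_mono) auto
    \<comment> \<open>The product equals \<open>r - Y\<close>; its second factor is nonnegative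
      because \<open>t\<close> and \<open>t0\<close> are at least \<open>1 / y m\<close> and
      \<open>k \<le> 1\<close>.\<close>
    then have "0 \<le> (t - t0) * (t + t0 - k / y m)"
      using t_ge t0_ge ym by (intro mult_nonneg_nonneg) (auto intro: order_trans simp: t_def yn less_imp_le)
    then have "Y \<le> r"
      unfolding r_eq Y_eq by (simp add: algebra_simps power2_eq_square diff_divide_distrib)
    moreover have "Y > 0"
      unfolding Y_def using AB E(1) m1
      by (intro add_pos_nonneg divide_pos_pos divide_nonneg_pos mult_nonneg_nonneg mult_pos_pos) auto
    moreover have "turan_gap y n = 1 / r - r"
    proof (cases n)
      case 0
      then show ?thesis by (simp add: turan_gap_def r_def t_def m_def power2_eq_square)
    next
      case (Suc l)
      have "r = y l / y n"
        using rec[of l] by (simp add: Suc r_def t_def m_def)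
      then show ?thesis by (simp add: Suc turan_gap_def)
    qed
    ultimately have g1: "turan_gap y n \<le> 1 / Y - Y"
      using inverse_minus_antimono by simp
    have g2: "turan_gap y (Suc m) \<le> A / B - B / A"
      using gap_next[of m] by (simp add: A_def B_def E_def)
    have "t0\<^sup>2 \<le> t\<^sup>2"
      using t_ge t0_ge ym by (intro power_mono) (auto intro: order_trans simp: t0_def AB less_imp_le)
    moreover have "t0\<^sup>2 > 0" using ym AB by (simp add: t0_def)
    ultimately have "t0\<^sup>2 - 1 / t0\<^sup>2 \<le> t\<^sup>2 - 1 / t\<^sup>2"
      using inverse_minus_antimono[of "t0\<^sup>2" "t\<^sup>2"] by simp
    moreover have "t0\<^sup>2 = A\<^sup>2 / (E * B\<^sup>2)"
      by (simp add: t0_def E_def power_divide power_mult_distrib)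
    ultimately have "A\<^sup>2 / (E * B\<^sup>2) - E * B\<^sup>2 / A\<^sup>2 \<le> 1 / (y n)\<^sup>2 - (y n)\<^sup>2"
      by (simp add: t_def power_divide)
    moreover have "(A / B - B / A) + (1 / Y - Y) \<le> E - 1 / E + A\<^sup>2 / (E * B\<^sup>2) - E * B\<^sup>2 / A\<^sup>2"
      using gap_rational_inequality[OF E(1) m1] by (simp add: A_def B_def Y_def)
    ultimately show ?thesis
      using g1 g2 by (simp add: m_def E_def)
  qed
  then show ?thesis
    using 0 y_pos by (simp add: gap_condition_def)
qed

text \<open>Two consecutive instances of the recurrence give the increment as \<open>2 * w\<close>
  plus a difference of reciprocals. Once \<open>y\<close> has reached \<open>1 / w\<close>, that
  difference lies between \<open>- w\<close> and 0.\<close>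

lemma increment_bounds:
  assumes "1 / w \<le> y (Suc n)"
  shows "w \<le> y (Suc n) - y n" "y (Suc n) - y n \<le> 2 * w"
proof -
  have eq: "y (Suc n) - y n = 2 * w + 1 / y (Suc (Suc n)) - 1 / y (Suc n)"
    using rec[of n] rec[of "Suc n"] by (simp add: algebra_simps)
  have "1 / y (Suc n) \<le> w"
    using assms w_pos y_pos[of "Suc n"] by (simp add: field_simps)
  moreover have "1 / y (Suc (Suc n)) > 0" using y_pos by simp
  ultimately show "w \<le> y (Suc n) - y n" using eq by linarith
  have "1 / y (Suc (Suc n)) \<le> 1 / y (Suc n)"
    using y_mono[of "Suc n"] y_pos[of "Suc n"] by (intro divide_left_mono) (auto simp: y_pos)
  then show "y (Suc n) - y n \<le> 2 * w" using eq by linarith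
qed

lemma y_lower: "2 * (real n + 1) * w \<le> y n"
  using rec[of n] y_pos[of "Suc n"] by simp

lemma y_mono': "m \<le> n \<Longrightarrow> y m \<le> y n"
  using y_mono by (rule lift_Suc_mono_le)

text \<open>Beyond \<open>N\<close> the increments of \<open>y\<close> are replaced by a geometric sequence, which makes the
  sequence bounded; the gap condition survives because it has room to spare once \<open>y\<close> is large.\<close>

lemma truncation:
  "\<exists>z. gap_condition z \<and> (\<exists>K. \<forall>n. z n \<le> K) \<and> (\<forall>n. 1 \<le> z n) \<and> (\<forall>n. z n \<le> z (Suc n))
     \<and> (\<forall>n. z n \<le> y n) \<and> (\<forall>n\<le>N0. z n = y n)"
proof -
  \<comment> \<open>Each entry serves one estimate: 3 yields the factor 9 in the geometric range,
    \<open>2 * w\<close> keeps the increments of \<open>z\<close> below its values, and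
    \<open>1 / w\<close> makes \<open>increment_bounds\<close> applicable.\<close>
  define M where "M = Max {3, 2 * w, 1 / w}"
  obtain N1 :: nat where N1: "M / (2 * w) < real N1" using reals_Archimedean2 by blast
  define N' where "N' = max N0 N1"
  \<comment> \<open>The tail starts at \<open>N\<close>, one index after \<open>N'\<close>, so that
    its reference increment \<open>g\<close> is a genuine increment of \<open>y\<close>; from there
    on the increments of \<open>z\<close> halve at every step.\<close>
  define N where "N = Suc N'"
  have "M < 2 * real N1 * w" using N1 w_pos by (simp add: field_simps)
  also have "\<dots> \<le> 2 * (real N' + 1) * w"
    using w_pos by (intro mult_right_mono) (auto simp: N'_def)
  also have "\<dots> \<le> y N'" by (rule y_lower)
  finally have M: "M < y N'" .
  have M3: "3 \<le> M" "2 * w \<le> M" "1 / w \<le> M" by (auto simp: M_def)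
  define g where "g = y N - y N'"
  define z where "z n = (if n \<le> N then y n else y N + g * (1 - (1/2) ^ (n - N)))" for n
  have large: "1 / w \<le> y n" if "n \<ge> N'" for n
    using y_mono'[OF that] M M3 by linarith
  have g: "w \<le> g" "g \<le> 2 * w"
    using increment_bounds[of N'] large by (auto simp: g_def N_def)
  have g0: "g > 0" using g w_pos by linarith
  have z_eq: "z n = y n" if "n \<le> N" for n using that by (simp add: z_def)
  have z_add: "z (N + k) = y N + g * (1 - (1/2) ^ k)" for k
    by (cases "k = 0") (auto simp: z_def)
  have y_add: "y N + real k * w \<le> y (N + k)" for k
  proof (induction k)
    case (Suc k)
    then show ?case
      using increment_bounds(1)[of "N + k"] large[of "Suc (N + k)"]
      by (simp add: N_def algebra_simps)
  qed simp
  have z_le: "z n \<le> y n" for n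
  proof (cases "n \<le> N")
    case False
    then obtain k where k: "n = N + Suc k" by (metis add_Suc_right less_imp_Suc_add not_le)
    \<comment> \<open>The increments of \<open>y\<close> are at least \<open>w\<close>, while those
      of \<open>z\<close> after \<open>N\<close> sum over \<open>k + 1\<close> steps to at most
      \<open>w * (2 - (1/2) ^ k)\<close>, which does not exceed \<open>w * (k + 1)\<close>.\<close>
    have "g * (1 - (1/2) ^ Suc k) \<le> 2 * w * (1 - (1/2) ^ Suc k)"
      using g by (intro mult_right_mono) (auto simp: power_le_one simp del: power_Suc)
    also have "\<dots> = w * (2 - (1/2) ^ k)" by (simp add: algebra_simps)
    also have "\<dots> \<le> w * real (Suc k)"
    proof (intro mult_left_mono)
      show "2 - (1 / 2) ^ k \<le> real (Suc k)"
        by (cases k) (auto simp: algebra_simps)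
    qed (use w_pos in auto)
    finally show ?thesis using y_add[of "Suc k"] by (simp only: k z_add mult.commute)
  qed (simp add: z_eq)
  have z_pos: "z n > 0" for n
  proof (cases "n \<le> N")
    case False
    then obtain k where k: "n = N + k" by (metis less_imp_add_positive not_le)
    have "g * (1 - (1/2) ^ k) \<ge> 0" using g0 by (intro mult_nonneg_nonneg) (auto simp: power_le_one)
    then show ?thesis using y_pos[of N] by (simp add: k z_add)
  qed (simp add: z_eq y_pos)
  have z_bound: "z n \<le> y N + g" for n
  proof (cases "n \<le> N")
    case False
    then obtain k where k: "n = N + k" by (metis less_imp_add_positive not_le)
    have "g * (1 - (1/2) ^ k) \<le> g * 1" using g0 by (intro mult_left_mono) auto
    then show ?thesis by (simp add: k z_add)
  qed (use g0 y_mono'[of n N] in \<open>simp add: z_eq\<close>)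
  have z_ge_1: "1 \<le> z n" for n
  proof (cases "n \<le> N")
    case False
    then obtain k where k: "n = N + k" by (metis less_imp_add_positive not_le)
    have "g * (1 - (1/2) ^ k) \<ge> 0" using g0 by (intro mult_nonneg_nonneg) (auto simp: power_le_one)
    then show ?thesis using y_ge_1[of N] by (simp add: k z_add)
  qed (simp add: z_eq y_ge_1)
  have z_mono: "z n \<le> z (Suc n)" for n
  proof (cases "n < N")
    case False
    then obtain k where k: "n = N + k" by (metis le_Suc_ex not_le)
    have "g * (1 - (1/2) ^ k) \<le> g * (1 - (1/2) ^ Suc k)" using g0 by (intro mult_left_mono) auto
    then show ?thesis using z_add[of k] z_add[of "Suc k"] by (simp add: k)
  qed (simp add: z_eq y_mono)
  have gap_eq: "turan_gap z n = turan_gap y n" if "n \<le> N" for n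
    using that by (auto simp: turan_gap_def z_eq split: nat.split)
  have gap_y: "turan_gap y (Suc (Suc n)) + turan_gap y n
      \<le> (y (Suc n))\<^sup>2 - 1 / (y (Suc n))\<^sup>2 + 1 / (y n)\<^sup>2 - (y n)\<^sup>2" for n
    using gap_condition by (simp add: gap_condition_def)
  have "turan_gap z (Suc (Suc n)) + turan_gap z n
      \<le> (z (Suc n))\<^sup>2 - 1 / (z (Suc n))\<^sup>2 + 1 / (z n)\<^sup>2 - (z n)\<^sup>2" for n
  proof -
    consider "Suc (Suc n) \<le> N" | "Suc n = N" | k where "n = N + k"
      by (metis add_diff_inverse_nat le_Suc_eq not_less_eq_eq not_le nat_le_linear)
    then show ?thesis
    proof cases
      case 1
      then show ?thesis using gap_y[of n] by (simp add: gap_eq z_eq)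
    next
      case 2
      \<comment> \<open>Here only the gap at \<open>N + 1\<close> has changed, and lowering
        \<open>z (Suc N)\<close> lowers that gap.\<close>
      have "z (Suc N) / z N - z N / z (Suc N) \<le> y (Suc N) / y N - y N / y (Suc N)"
        using z_le[of "Suc N"] z_pos[of "Suc N"] y_pos[of N] y_pos[of "Suc N"]
        unfolding z_eq[OF order_refl]
        by (intro diff_mono divide_right_mono divide_left_mono) auto
      then have "turan_gap z (Suc N) \<le> turan_gap y (Suc N)"
        by (simp add: turan_gap_def)
      then show ?thesis using gap_y[of n] 2 by (simp add: gap_eq z_eq)
    next
      case 3
      \<comment> \<open>Around \<open>a = z n\<close> the successive increments are
        \<open>2 * h\<close>, \<open>h\<close> and \<open>h / 2\<close>. In units of
        \<open>h / (a + h)\<close> the two gaps on the left are bounded by 16 and 1, and the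
        right-hand side is at least 18.\<close>
      define h where "h = g * (1/2) ^ Suc k"
      define a where "a = z n"
      define c where "c = a - 2 * h"
      have h0: "h > 0" using g0 by (simp add: h_def)
      have z1: "z (Suc n) = a + h"
        using z_add[of "Suc k"] z_add[of k] by (simp add: 3 a_def h_def algebra_simps)
      have z2: "z (Suc (Suc n)) = a + h + h / 2"
        using z_add[of "Suc (Suc k)"] z_add[of k] by (simp add: 3 a_def h_def algebra_simps)
      have zp: "z (n - 1) = c"
      proof (cases k)
        case 0
        then show ?thesis
          using z_add[of 0] by (simp add: 3 a_def c_def h_def N_def z_eq g_def field_simps)
      next
        case (Suc l)
        then show ?thesis
          using z_add[of k] z_add[of l] by (simp add: 3 a_def c_def h_def algebra_simps)
      qed
      have "h \<le> g / 2" using g0 by (simp add: h_def power_le_one mult_left_le)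
      moreover have "z (n - 1) \<ge> y N'"
      proof (cases k)
        case 0
        then show ?thesis by (simp add: 3 N_def z_eq)
      next
        case (Suc l)
        have "g * (1 - (1/2) ^ l) \<ge> 0" using g0 by (intro mult_nonneg_nonneg) (auto simp: power_le_one)
        then show ?thesis
          using z_add[of l] y_mono'[of N' N] by (simp add: 3 Suc N_def)
      qed
      ultimately have c: "c > 3" "h \<le> c" using zp M M3 g w_pos by linarith+
      obtain l where n: "n = Suc l" by (simp add: 3 N_def)
      have gap_n: "turan_gap z n = a / c - c / a"
        using zp by (simp add: n turan_gap_def a_def)
      have "turan_gap z n = 2 * h * (1 / c + 1 / a)"
        unfolding gap_n using c h0 by (simp add: c_def field_simps)
      also have "\<dots> \<le> 2 * h * (1 / c + 1 / c)"
        using c h0 by (intro mult_left_mono add_left_mono divide_left_mono) (auto simp: c_def)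
      also have "\<dots> = 4 * h / c" by simp
      \<comment> \<open>Since \<open>a + h = c + 3 * h\<close> and \<open>h \<le> c\<close>, the
        denominator \<open>a + h\<close> is at most \<open>4 * c\<close>.\<close>
      also have "\<dots> \<le> 16 * h / (a + h)"
        using c h0 by (simp add: c_def field_simps)
      finally have g1: "turan_gap z n \<le> 16 * h / (a + h)" .
      have "turan_gap z (Suc (Suc n)) = h / 2 * (1 / (a + h) + 1 / (a + h + h / 2))"
        unfolding turan_gap_def using c h0 by (simp add: z1 z2 c_def field_simps)
      also have "\<dots> \<le> h / 2 * (1 / (a + h) + 1 / (a + h))"
        using c h0 by (intro mult_left_mono add_left_mono divide_left_mono) (auto simp: c_def)
      also have "\<dots> = h / (a + h)" by simp
      finally have g2: "turan_gap z (Suc (Suc n)) \<le> h / (a + h)" .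
      have ac: "a > 3" using c h0 by (simp add: c_def)
      have gm: "2 * h / (a + h) \<le> (a + h) / a - a / (a + h)"
      proof -
        have "(a + h) / a - a / (a + h) = h / a + h / (a + h)"
          using ac h0 by (simp add: field_simps)
        moreover have "h / (a + h) \<le> h / a" using ac h0 by (intro divide_left_mono) auto
        ultimately show ?thesis by simp
      qed
      \<comment> \<open>The right-hand side of the gap condition is used in factored form; the
        second factor is at least 9 because \<open>a > 3\<close>.\<close>
      have "3 * 3 \<le> a * (a + h)" using ac h0 by (intro mult_mono) auto
      moreover have "1 / (a * (a + h)) \<ge> 0" using ac h0 by simp
      ultimately have "9 \<le> a * (a + h) + 1 / (a * (a + h))" by linarith
      then have "2 * h / (a + h) * 9 \<le> ((a + h) / a - a / (a + h)) * (a * (a + h) + 1 / (a * (a + h)))"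
      proof (intro mult_mono gm)
        have "2 * h / (a + h) \<ge> 0" using ac h0 by simp
        then show "0 \<le> (a + h) / a - a / (a + h)" using gm by linarith
      qed auto
      also have "\<dots> = (a + h)\<^sup>2 - 1 / (a + h)\<^sup>2 + 1 / a\<^sup>2 - a\<^sup>2"
      proof -
        have "(b / a - a / b) * (a * b + 1 / (a * b)) = b\<^sup>2 - 1 / b\<^sup>2 + 1 / a\<^sup>2 - a\<^sup>2" if "b > 0" for b
          using ac that by (simp add: field_simps power2_eq_square)
        then show ?thesis using ac h0 by simp
      qed
      finally have "2 * h / (a + h) * 9 \<le> (a + h)\<^sup>2 - 1 / (a + h)\<^sup>2 + 1 / a\<^sup>2 - a\<^sup>2" .
      moreover have "2 * h / (a + h) * 9 = 16 * h / (a + h) + h / (a + h) + h / (a + h)"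
        by (simp add: add_divide_distrib[symmetric])
      moreover have "h / (a + h) \<ge> 0" using ac h0 by simp
      ultimately show ?thesis using g1 g2 unfolding z1 a_def[symmetric] by linarith
    qed
  qed
  moreover have "turan_gap z 1 \<le> turan_gap z 0"
    using gap_condition by (simp add: gap_eq N_def gap_condition_def)
  ultimately have "gap_condition z" using z_pos by (simp add: gap_condition_def)
  moreover have "\<forall>n\<le>N0. z n = y n" by (simp add: z_eq N_def N'_def)
  ultimately show ?thesis using z_bound z_le z_ge_1 z_mono by blast
qed

end

section \<open>The Riccati equation for ratios of Bessel functions\<close>

text \<open>A comparison principle with initial condition at 0. If \<open>K x > 0\<close>, take the
  last point \<open>m\<close> before \<open>x\<close> at which \<open>K\<close> is at most
  \<open>K x / 2\<close>. Beyond it \<open>K\<close> is positive, hence cannot increase, so it never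
  reaches \<open>K x\<close>.\<close>

lemma nonpos_if_decreasing_where_positive:
  fixes K K' :: "real \<Rightarrow> real"
  assumes der: "\<And>x. x > 0 \<Longrightarrow> (K has_real_derivative K' x) (at x)"
    and dec: "\<And>x. x > 0 \<Longrightarrow> K x > 0 \<Longrightarrow> K' x \<le> 0"
    and lim: "\<And>e. e > 0 \<Longrightarrow> eventually (\<lambda>x. K x < e) (at_right 0)"
    and "x > 0"
  shows "K x \<le> 0"
proof (rule ccontr)
  assume "\<not> K x \<le> 0"
  then have pos: "K x > 0" by simp
  have "eventually (\<lambda>z. K z < K x / 2) (at_right 0)" using pos by (intro lim) simp
  then obtain b where b: "b > 0" "\<And>z. 0 < z \<Longrightarrow> z < b \<Longrightarrow> K z < K x / 2"
    by (auto simp: eventually_at_right_field)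
  define a where "a = min (b / 2) (x / 2)"
  have a: "0 < a" "a < x" "K a < K x / 2" using b \<open>x > 0\<close> by (auto simp: a_def)
  define S where "S = {a..x} \<inter> K -` {..K x / 2}"
  have cont: "continuous_on {a..x} K"
  proof (intro continuous_at_imp_continuous_on ballI)
    fix z assume "z \<in> {a..x}"
    then show "isCont K z" using a(1) by (intro DERIV_isCont[OF der]) simp
  qed
  have "closed S" unfolding S_def
    by (intro continuous_closed_preimage cont) auto
  moreover have "bounded S"
    unfolding S_def by (rule bounded_subset[OF bounded_closed_interval[of a x]]) auto
  ultimately have "compact S" by (simp add: compact_eq_bounded_closed)
  moreover have "a \<in> S" using a by (simp add: S_def)
  ultimately obtain m where m: "m \<in> S" "\<And>z. z \<in> S \<Longrightarrow> z \<le> m"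
    using compact_attains_sup[of S] by blast
  have mx: "a \<le> m" "m < x" "K m \<le> K x / 2"
    using m(1) pos by (auto simp: S_def order.strict_iff_order)
  obtain z where z: "m < z" "z < x" "K x - K m = (x - m) * K' z"
  proof -
    have "(K has_real_derivative K' z) (at z)" if "m \<le> z" for z
      using that a mx by (intro der) linarith
    then show ?thesis using MVT2[OF mx(2), of K K'] that by blast
  qed
  have "K z > 0"
  proof (rule ccontr)
    assume "\<not> K z > 0"
    then have "z \<in> S" using z mx pos by (simp add: S_def)
    then show False using m(2) z(1) by fastforce
  qed
  then have "K' z \<le> 0" using dec[of z] z mx a by simp
  then have "(x - m) * K' z \<le> 0" using mx by (simp add: mult_nonneg_nonpos)
  then show False using z(3) mx pos by linarith
qed

definition bessel_ratio :: "real \<Rightarrow> nat \<Rightarrow> real" where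
  "bessel_ratio x n = bessel_I (int n) x / bessel_I (int (Suc n)) x"

lemma bessel_ratio_pos: "x > 0 \<Longrightarrow> bessel_ratio x n > 0"
  by (simp add: bessel_ratio_def bessel_I_pos)

lemma bessel_ratio_rec:
  assumes "x > 0"
  shows "bessel_ratio x n = 2 * (real n + 1) * (1 / x) + 1 / bessel_ratio x (Suc n)"
proof -
  have "x * (bessel_I (int n) x - bessel_I (int (Suc (Suc n))) x)
      = 2 * (real n + 1) * bessel_I (int (Suc n)) x"
    using bessel_I_recurrence[of x "int (Suc n)"] by (simp add: algebra_simps)
  then show ?thesis
    using assms bessel_I_pos[OF assms, of "int (Suc n)"] bessel_I_pos[OF assms, of "int (Suc (Suc n))"]
    unfolding bessel_ratio_def by (simp add: field_simps)
qed

text \<open>The Riccati equation. Combining the derivative formula with the recurrence expresses the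
  derivatives of the Bessel functions of orders \<open>n\<close> and \<open>n + 1\<close> through
  these two functions alone.\<close>

lemma DERIV_bessel_ratio:
  assumes "x > 0"
  shows "((\<lambda>x. bessel_ratio x n) has_real_derivative
    1 - (bessel_ratio x n)\<^sup>2 + (2 * real n + 1) * bessel_ratio x n / x) (at x)"
proof -
  define a b where "a = bessel_I (int n) x" and "b = bessel_I (int (Suc n)) x"
  have ab: "a > 0" "b > 0" using assms by (simp_all add: a_def b_def bessel_I_pos)
  have da: "(bessel_I (int n) has_real_derivative b + real n * a / x) (at x)"
    using DERIV_bessel_I[of "int n" x] bessel_I_recurrence[of x "int n"] assms
    by (rule_tac DERIV_cong) (auto simp: a_def b_def field_simps)
  have db: "(bessel_I (int (Suc n)) has_real_derivative a - (real n + 1) * b / x) (at x)"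
    using DERIV_bessel_I[of "int (Suc n)" x] bessel_I_recurrence[of x "int (Suc n)"] assms
    by (rule_tac DERIV_cong) (auto simp: a_def b_def field_simps)
  have "((\<lambda>x. bessel_I (int n) x / bessel_I (int (Suc n)) x) has_real_derivative
      ((b + real n * a / x) * b - a * (a - (real n + 1) * b / x)) / (b * b)) (at x)"
    using DERIV_divide[OF da db] ab by (simp add: a_def b_def)
  also have "((b + real n * a / x) * b - a * (a - (real n + 1) * b / x)) / (b * b)
      = 1 - (a / b)\<^sup>2 + (2 * real n + 1) * (a / b) / x"
    using ab assms by (simp add: field_simps power2_eq_square)
  finally show ?thesis
    unfolding bessel_ratio_def a_def b_def .
qed

section \<open>Bounds for the ratios by comparison\<close>

lemma bessel_ratio_ge: "x > 0 \<Longrightarrow> 2 * (real n + 1) / x \<le> bessel_ratio x n"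
  using bessel_ratio_rec[of x n] bessel_ratio_pos[of x "Suc n"] by simp

text \<open>Where the ratio is below 1, the Riccati equation makes it increase with
  \<open>x\<close>; near 0 it is large by \<open>bessel_ratio_ge\<close>.\<close>

lemma bessel_ratio_ge_1:
  assumes "x > 0"
  shows "bessel_ratio x n \<ge> 1"
proof -
  have "1 - bessel_ratio x n \<le> 0"
  proof (rule nonpos_if_decreasing_where_positive[OF _ _ _ assms])
    fix x :: real assume x: "x > 0"
    let ?y = "bessel_ratio x n"
    show "((\<lambda>x. 1 - bessel_ratio x n) has_real_derivative
        - (1 - ?y\<^sup>2 + (2 * real n + 1) * ?y / x)) (at x)"
      using DERIV_diff[OF DERIV_const DERIV_bessel_ratio[OF x]] by simp
    assume "1 - ?y > 0"
    then have "?y\<^sup>2 \<le> 1" using bessel_ratio_pos[OF x, of n] by (simp add: power_le_one)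
    moreover have "(2 * real n + 1) * ?y / x \<ge> 0" using bessel_ratio_pos[OF x, of n] x by simp
    ultimately show "- (1 - ?y\<^sup>2 + (2 * real n + 1) * ?y / x) \<le> 0" by linarith
  next
    fix e :: real assume e: "e > 0"
    have "1 - bessel_ratio x n < e" if "0 < x" "x < 2" for x
    proof -
      have "1 < 2 / x" using that by simp
      also have "\<dots> \<le> 2 * (real n + 1) / x" using that by (intro divide_right_mono) auto
      finally show ?thesis using bessel_ratio_ge[OF that(1), of n] e by linarith
    qed
    then show "\<forall>\<^sub>F x in at_right 0. 1 - bessel_ratio x n < e"
      unfolding eventually_at_right_field by (intro exI[of _ 2]) auto
  qed
  then show ?thesis by simp
qed

text \<open>With \<open>s = ln y\<close> and \<open>\<theta> = 2 x sinh s - (2 n + 1)\<close> the Riccati equation for the ratio reads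
  \<open>s' = - \<theta> / x\<close>, \<open>\<theta>' = 2 cosh s (tanh s - \<theta>)\<close>. As \<open>\<theta>\<close> tends to 1 at 0, it stays above \<open>tanh s\<close>.\<close>

definition riccati_excess :: "nat \<Rightarrow> real \<Rightarrow> real" where
  "riccati_excess n x = x * (bessel_ratio x n - 1 / bessel_ratio x n) - (2 * real n + 1)"

lemma DERIV_riccati_excess:
  fixes n :: nat
  assumes "x > 0"
  defines "y \<equiv> bessel_ratio x n"
  shows "(riccati_excess n has_real_derivative y - 1 / y - (y + 1 / y) * riccati_excess n x) (at x)"
proof -
  have y: "y > 0" using bessel_ratio_pos[OF assms(1)] by (simp add: y_def)
  define D where "D = 1 - y\<^sup>2 + (2 * real n + 1) * y / x"
  have d: "((\<lambda>x. bessel_ratio x n) has_real_derivative D) (at x)"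
    using DERIV_bessel_ratio[OF assms(1), of n] by (simp add: D_def y_def)
  have "((\<lambda>x. x * (bessel_ratio x n - 1 / bessel_ratio x n) - (2 * real n + 1)) has_real_derivative
      (y - 1 / y) + x * (D + D / (y * y))) (at x)"
    using y unfolding y_def by (auto intro!: derivative_eq_intros d simp: field_simps)
  also have "(y - 1 / y) + x * (D + D / (y * y)) = y - 1 / y - (y + 1 / y) * riccati_excess n x"
    using y assms(1) unfolding D_def riccati_excess_def y_def[symmetric]
    by (simp add: field_simps power2_eq_square)
  finally show ?thesis
    unfolding riccati_excess_def .
qed

text \<open>This supplies the initial condition for the two comparison arguments that follow. The
  recurrence turns the excess into 1 plus a positive term minus \<open>x / y\<close>, and
  \<open>y \<ge> 1 / x\<close>.\<close>

lemma riccati_excess_near_0: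
  assumes "x > 0"
  shows "1 - x\<^sup>2 \<le> riccati_excess n x"
proof -
  let ?y = "bessel_ratio x n"
  have y: "?y > 0" "bessel_ratio x (Suc n) > 0" using bessel_ratio_pos[OF assms] by auto
  have "riccati_excess n x = 1 + x / bessel_ratio x (Suc n) - x / ?y"
    using bessel_ratio_rec[OF assms, of n] assms unfolding riccati_excess_def
    by (simp add: right_diff_distrib) (simp add: field_simps)
  moreover have "1 / x \<le> ?y"
    using bessel_ratio_ge[OF assms, of n] assms
    by (smt (verit) divide_right_mono of_nat_0_le_iff)
  then have "x / ?y \<le> x\<^sup>2"
    using assms y by (simp add: field_simps power2_eq_square)
  moreover have "x / bessel_ratio x (Suc n) \<ge> 0" using y assms by simp
  ultimately show ?thesis by linarith
qed

text \<open>Where the excess is negative, both terms of its derivative are nonnegative. The result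
  means that the ratio is nonincreasing in \<open>x\<close>, which the next comparison
  requires.\<close>

lemma riccati_excess_nonneg:
  assumes "x > 0"
  shows "riccati_excess n x \<ge> 0"
proof -
  have "- riccati_excess n x \<le> 0"
  proof (rule nonpos_if_decreasing_where_positive[OF _ _ _ assms])
    fix x :: real assume x: "x > 0"
    let ?y = "bessel_ratio x n" and ?t = "riccati_excess n x"
    have y: "?y \<ge> 1" using bessel_ratio_ge_1[OF x] .
    show "((\<lambda>x. - riccati_excess n x) has_real_derivative - (?y - 1 / ?y - (?y + 1 / ?y) * ?t)) (at x)"
      using DERIV_minus[OF DERIV_riccati_excess[OF x]] .
    assume "- ?t > 0"
    then have "(?y + 1 / ?y) * ?t \<le> 0" using y by (intro mult_nonneg_nonpos) auto
    moreover have "1 / ?y \<le> ?y" using y by (simp add: order_trans[of _ 1])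
    ultimately show "- (?y - 1 / ?y - (?y + 1 / ?y) * ?t) \<le> 0" by linarith
  next
    fix e :: real assume e: "e > 0"
    have "- riccati_excess n x < e" if "0 < x" "x < 1" for x
      using riccati_excess_near_0[OF that(1), of n] that e power_le_one[of x 2] by linarith
    then show "\<forall>\<^sub>F x in at_right 0. - riccati_excess n x < e"
      unfolding eventually_at_right_field by (intro exI[of _ 1]) auto
  qed
  then show ?thesis by simp
qed

text \<open>The left-hand side is \<open>tanh (ln y)\<close>. It is nonincreasing in
  \<open>x\<close> because \<open>y\<close> is, and wherever the excess lies below it the excess
  increases; so the difference cannot grow while positive. Near 0 the excess is at least
  \<open>1 - x\<^sup>2\<close> and the hyperbolic tangent is below 1.\<close>

lemma riccati_excess_lower_bound:
  fixes n :: nat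
  assumes "x > 0"
  defines "y \<equiv> bessel_ratio x n"
  shows "1 - 2 / (y\<^sup>2 + 1) \<le> riccati_excess n x"
proof -
  have "1 - 2 / ((bessel_ratio x n)\<^sup>2 + 1) - riccati_excess n x \<le> 0"
  proof (rule nonpos_if_decreasing_where_positive[OF _ _ _ assms(1)])
    fix x :: real assume x: "x > 0"
    let ?y = "bessel_ratio x n" and ?t = "riccati_excess n x"
    have y: "?y \<ge> 1" using bessel_ratio_ge_1[OF x] .
    have pos: "?y\<^sup>2 + 1 > 0" by (simp add: add_nonneg_pos)
    define D where "D = 1 - ?y\<^sup>2 + (2 * real n + 1) * ?y / x"
    have d: "((\<lambda>x. bessel_ratio x n) has_real_derivative D) (at x)"
      using DERIV_bessel_ratio[OF x, of n] by (simp add: D_def)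
    have D: "D = - ?y * ?t / x"
      using x y by (simp add: D_def riccati_excess_def field_simps power2_eq_square)
    show "((\<lambda>x. 1 - 2 / ((bessel_ratio x n)\<^sup>2 + 1) - riccati_excess n x) has_real_derivative
        4 * ?y * D / (?y\<^sup>2 + 1)\<^sup>2 - (?y - 1 / ?y - (?y + 1 / ?y) * ?t)) (at x)"
      using pos by (auto intro!: derivative_eq_intros d DERIV_riccati_excess[OF x] simp: power2_eq_square)
    assume K: "1 - 2 / (?y\<^sup>2 + 1) - ?t > 0"
    have "D \<le> 0" using riccati_excess_nonneg[OF x, of n] y x by (simp add: D)
    then have "4 * ?y * D / (?y\<^sup>2 + 1)\<^sup>2 \<le> 0"
      using y pos by (intro divide_nonpos_pos mult_nonneg_nonpos) auto
    moreover have "?y - 1 / ?y - (?y + 1 / ?y) * ?t = (?y + 1 / ?y) * (1 - 2 / (?y\<^sup>2 + 1) - ?t)"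
    proof -
      have "?y + 1 / ?y = (?y\<^sup>2 + 1) / ?y" "1 - 2 / (?y\<^sup>2 + 1) = (?y\<^sup>2 - 1) / (?y\<^sup>2 + 1)"
        using y pos by (simp_all add: field_simps power2_eq_square)
      then have "(?y + 1 / ?y) * (1 - 2 / (?y\<^sup>2 + 1)) = (?y\<^sup>2 - 1) / ?y"
        using pos by simp
      also have "\<dots> = ?y - 1 / ?y" using y by (simp add: field_simps power2_eq_square)
      finally show ?thesis by (simp only: right_diff_distrib)
    qed
    moreover have "(?y + 1 / ?y) * (1 - 2 / (?y\<^sup>2 + 1) - ?t) \<ge> 0"
      using K y by (intro mult_nonneg_nonneg) auto
    ultimately show "4 * ?y * D / (?y\<^sup>2 + 1)\<^sup>2 - (?y - 1 / ?y - (?y + 1 / ?y) * ?t) \<le> 0"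
      by linarith
  next
    fix e :: real assume e: "e > 0"
    have "1 - 2 / ((bessel_ratio x n)\<^sup>2 + 1) - riccati_excess n x < e" if "0 < x" "x < min 1 e" for x
    proof -
      have "2 / ((bessel_ratio x n)\<^sup>2 + 1) \<ge> 0" by simp
      moreover have "x\<^sup>2 < e"
        using that mult_strict_mono[of x 1 x e] by (simp add: power2_eq_square)
      ultimately show ?thesis
        using riccati_excess_near_0[OF that(1), of n] by linarith
    qed
    then show "\<forall>\<^sub>F x in at_right 0. 1 - 2 / ((bessel_ratio x n)\<^sup>2 + 1) - riccati_excess n x < e"
      unfolding eventually_at_right_field using e by (intro exI[of _ "min 1 e"]) auto
  qed
  then show ?thesis by (simp add: y_def)
qed

lemma ratio_sequence_bessel:
  assumes "x > 0"
  shows "ratio_sequence (bessel_ratio x) (1 / x)"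
proof
  fix n
  let ?y = "bessel_ratio x n"
  show "1 / x * (2 * real n + 2 * ?y\<^sup>2 / (?y\<^sup>2 + 1)) \<le> ?y - 1 / ?y"
  proof -
    have "2 * ?y\<^sup>2 / (?y\<^sup>2 + 1) = 1 + (1 - 2 / (?y\<^sup>2 + 1))"
      by (simp add: field_simps add_nonneg_eq_0_iff)
    then have "2 * real n + 2 * ?y\<^sup>2 / (?y\<^sup>2 + 1) \<le> x * (?y - 1 / ?y)"
      using riccati_excess_lower_bound[OF assms, of n] by (simp add: riccati_excess_def)
    then show ?thesis using assms by (simp add: field_simps)
  qed
  show "0 < ?y" "1 \<le> ?y" using assms bessel_ratio_pos bessel_ratio_ge_1 by auto
  show "?y = 2 * (real n + 1) * (1 / x) + 1 / bessel_ratio x (Suc n)"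
    using assms by (rule bessel_ratio_rec)
qed (use assms in simp)

section \<open>Hyponormal difference operators\<close>

lemma has_sum_finite_sum:
  fixes f :: "'k \<Rightarrow> 'a \<Rightarrow> 'b :: topological_comm_monoid_add"
  assumes "finite A" "\<And>k. k \<in> A \<Longrightarrow> (f k has_sum S k) B"
  shows "((\<lambda>j. \<Sum>k\<in>A. f k j) has_sum (\<Sum>k\<in>A. S k)) B"
  using assms by (induction A rule: finite_induct) (auto intro: has_sum_add)

lemma has_sum_diff:
  fixes f g :: "'a \<Rightarrow> 'b :: real_normed_vector"
  assumes "(f has_sum a) B" "(g has_sum b) B"
  shows "((\<lambda>j. f j - g j) has_sum a - b) B"
  using has_sum_add[OF assms(1), of "\<lambda>j. - g j" "- b"] assms(2) by (simp add: has_sum_uminus)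

lemma ell2_summable: "f \<in> ell2 \<Longrightarrow> (\<lambda>j. (cmod (f j))\<^sup>2) summable_on UNIV"
  by (simp add: ell2_def)

lemma ell2_dominated:
  assumes "f \<in> ell2" "\<And>j. cmod (g j) \<le> K * cmod (f j)"
  shows "g \<in> ell2"
proof -
  have "(\<lambda>j. K\<^sup>2 * (cmod (f j))\<^sup>2) summable_on UNIV"
    by (intro summable_on_cmult_right ell2_summable assms)
  moreover have "(cmod (g j))\<^sup>2 \<le> K\<^sup>2 * (cmod (f j))\<^sup>2" for j
    using power_mono[OF assms(2), of j 2] by (simp add: power_mult_distrib)
  ultimately show ?thesis
    unfolding ell2_def mem_Collect_eq by (rule summable_on_comparison_test) auto
qed

lemma ell2_add:
  assumes "f \<in> ell2" "g \<in> ell2"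
  shows "(\<lambda>j. f j + g j) \<in> ell2"
proof -
  have "(\<lambda>j. 2 * (cmod (f j))\<^sup>2 + 2 * (cmod (g j))\<^sup>2) summable_on UNIV"
    by (intro summable_on_add summable_on_cmult_right ell2_summable assms)
  moreover have "(cmod (f j + g j))\<^sup>2 \<le> 2 * (cmod (f j))\<^sup>2 + 2 * (cmod (g j))\<^sup>2" for j
  proof -
    have "(cmod (f j + g j))\<^sup>2 \<le> (cmod (f j) + cmod (g j))\<^sup>2"
      by (intro power_mono norm_triangle_ineq) auto
    also have "\<dots> \<le> 2 * (cmod (f j))\<^sup>2 + 2 * (cmod (g j))\<^sup>2"
      using zero_le_power2[of "cmod (f j) - cmod (g j)"] by (simp add: power2_eq_square algebra_simps)
    finally show ?thesis .
  qed
  ultimately show ?thesis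
    unfolding ell2_def mem_Collect_eq by (rule summable_on_comparison_test) auto
qed

lemma ell2_cmult: "f \<in> ell2 \<Longrightarrow> (\<lambda>j. c * f j) \<in> ell2"
  by (rule ell2_dominated[where K = "cmod c"]) (auto simp: norm_mult)

lemma ell2_diff: "f \<in> ell2 \<Longrightarrow> g \<in> ell2 \<Longrightarrow> (\<lambda>j. f j - g j) \<in> ell2"
  using ell2_add[OF _ ell2_cmult[of g "-1"]] by simp

lemma ell2_sum: "finite A \<Longrightarrow> (\<And>k. k \<in> A \<Longrightarrow> f k \<in> ell2) \<Longrightarrow> (\<lambda>j. \<Sum>k\<in>A. f k j) \<in> ell2"
proof (induction A rule: finite_induct)
  case empty
  then show ?case by (simp add: ell2_def)
next
  case (insert k F)
  then show ?case using ell2_add[of "f k" "\<lambda>j. \<Sum>k\<in>F. f k j"] by simp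
qed

lemma ell2_shift:
  fixes f :: "'a :: group_add \<Rightarrow> complex"
  shows "f \<in> ell2 \<Longrightarrow> (\<lambda>j. f (j + a)) \<in> ell2"
  unfolding ell2_def mem_Collect_eq
  using summable_on_reindex_bij_betw[of "\<lambda>j. j + a" UNIV UNIV "\<lambda>j. (cmod (f j))\<^sup>2"]
  by (simp add: bij_plus_right)

lemma norm_le_ell2_norm:
  assumes "f \<in> ell2"
  shows "cmod (f j) \<le> ell2_norm f"
proof -
  have "(\<Sum>j\<in>{j}. (cmod (f j))\<^sup>2) \<le> (\<Sum>\<^sub>\<infinity>j. (cmod (f j))\<^sup>2)"
    using assms by (intro finite_sum_le_infsum ell2_summable) auto
  then show ?thesis
    unfolding ell2_norm_def by (simp add: real_le_rsqrt)
qed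

definition inner2 :: "('a \<Rightarrow> complex) \<Rightarrow> ('a \<Rightarrow> complex) \<Rightarrow> complex" where
  "inner2 f g = (\<Sum>\<^sub>\<infinity>j. cnj (f j) * g j)"

lemma inner2_summable:
  assumes "f \<in> ell2" "g \<in> ell2"
  shows "(\<lambda>j. cnj (f j) * g j) summable_on UNIV"
proof (rule abs_summable_summable)
  have "(\<lambda>j. (cmod (f j))\<^sup>2 + (cmod (g j))\<^sup>2) summable_on UNIV"
    by (intro summable_on_add ell2_summable assms)
  moreover have "norm (cnj (f j) * g j) \<le> (cmod (f j))\<^sup>2 + (cmod (g j))\<^sup>2" for j
    using sum_squares_bound[of "cmod (f j)" "cmod (g j)"] mult_nonneg_nonneg[of "cmod (f j)" "cmod (g j)"]
    unfolding norm_mult complex_mod_cnj by (simp del: mult_nonneg_nonneg)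
  ultimately show "(\<lambda>j. norm (cnj (f j) * g j)) summable_on UNIV"
    by (rule summable_on_comparison_test) auto
qed

lemma has_sum_inner2:
  "f \<in> ell2 \<Longrightarrow> g \<in> ell2 \<Longrightarrow> ((\<lambda>j. cnj (f j) * g j) has_sum inner2 f g) UNIV"
  unfolding inner2_def by (intro has_sum_infsum inner2_summable)

lemma has_sum_norm2:
  assumes "f \<in> ell2"
  shows "((\<lambda>j. (cmod (f j))\<^sup>2) has_sum Re (inner2 f f)) UNIV"
proof -
  have "Re (cnj z * z) = (cmod z)\<^sup>2" for z :: complex
    unfolding cmod_power2 by (simp add: power2_eq_square)
  then show ?thesis using has_sum_Re[OF has_sum_inner2[OF assms assms]] by simp
qed

lemma inner2_commute: "inner2 f g = cnj (inner2 g f)"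
  unfolding inner2_def infsum_cnj[symmetric] by (simp add: mult.commute)

lemma inner2_sum_right:
  assumes "finite A" "f \<in> ell2" "\<And>k. k \<in> A \<Longrightarrow> g k \<in> ell2"
  shows "inner2 f (\<lambda>j. \<Sum>k\<in>A. g k j) = (\<Sum>k\<in>A. inner2 f (g k))"
proof -
  have "((\<lambda>j. \<Sum>k\<in>A. cnj (f j) * g k j) has_sum (\<Sum>k\<in>A. inner2 f (g k))) UNIV"
    using assms by (intro has_sum_finite_sum has_sum_inner2) auto
  then show ?thesis
    unfolding inner2_def sum_distrib_left by (rule infsumI)
qed

lemma inner2_sum_left:
  assumes "finite A" "f \<in> ell2" "\<And>k. k \<in> A \<Longrightarrow> g k \<in> ell2"
  shows "inner2 (\<lambda>j. \<Sum>k\<in>A. g k j) f = (\<Sum>k\<in>A. inner2 (g k) f)"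
  using inner2_sum_right[OF assms] by (subst (1 2) inner2_commute) simp

section \<open>Shift operators conjugated by a product weight\<close>

lemma has_sum_shift:
  fixes f :: "'a :: group_add \<Rightarrow> 'b :: {comm_monoid_add, topological_space}"
  shows "((\<lambda>j. f (j + a)) has_sum S) UNIV \<longleftrightarrow> (f has_sum S) UNIV"
  using has_sum_reindex_bij_betw[of "\<lambda>j. j + a" UNIV UNIV f S] by (simp add: bij_plus_right)

text \<open>Up to sign, the coefficient of the mixed term in
  \<open>|Lk g|\<^sup>2 - |Ak g|\<^sup>2\<close> below. Its nonnegativity is log-convexity of
  \<open>v\<close>; for the reciprocal of the Bessel functions it is a Turan inequality.\<close>

definition weight_gap :: "(int \<Rightarrow> real) \<Rightarrow> int \<Rightarrow> real" where
  "weight_gap v m = v (m + 1) * v (m - 1) / (v m)\<^sup>2 - (v m)\<^sup>2 / (v (m + 1) * v (m - 1))"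

text \<open>The constant \<open>K\<close> keeps the conjugated shifts bounded on the square-summable
  families. The last two assumptions are what the one-dimensional hyponormality argument consumes:
  the first controls the mixed terms, the second the diagonal ones that remain.\<close>

locale admissible_weight =
  fixes v :: "int \<Rightarrow> real" and K :: real
  assumes v_pos: "v m > 0"
    and v_Suc_le: "v (m + 1) \<le> K * v m"
    and v_le_Suc: "v m \<le> K * v (m + 1)"
    and weight_gap_nonneg: "0 \<le> weight_gap v m"
    and weight_gap_sum: "weight_gap v (m + 1) + weight_gap v (m - 1)
      \<le> (v (m - 1) / v m)\<^sup>2 + (v (m + 1) / v m)\<^sup>2 - (v m / v (m + 1))\<^sup>2 - (v m / v (m - 1))\<^sup>2"
begin

lemma K_pos: "K > 0"
  using v_Suc_le[of 0] v_pos[of 0] v_pos[of "0 + 1"] by (smt (verit) zero_less_mult_iff)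

definition p :: "int \<Rightarrow> real" where "p m = v m / v (m + 1)"
definition q :: "int \<Rightarrow> real" where "q m = v m / v (m - 1)"

lemma p_pos: "p m > 0" and q_pos: "q m > 0"
  by (simp_all add: p_def q_def v_pos)

lemma p_le: "p m \<le> K" and q_le: "q m \<le> K"
  using v_le_Suc[of m] v_Suc_le[of "m - 1"] v_pos by (simp_all add: p_def q_def divide_le_eq)

text \<open>The sum of the two shifts in direction \<open>k\<close>, conjugated by the product of
  \<open>v\<close> over the coordinates.\<close>

definition Lk :: "'d \<Rightarrow> (int ^ 'd \<Rightarrow> complex) \<Rightarrow> int ^ 'd \<Rightarrow> complex" where
  "Lk k g j = of_real (p (j $ k)) * g (j + axis k 1) + of_real (q (j $ k)) * g (j - axis k 1)"

definition Ak :: "'d \<Rightarrow> (int ^ 'd \<Rightarrow> complex) \<Rightarrow> int ^ 'd \<Rightarrow> complex" where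
  "Ak k g j = of_real (q (j $ k + 1)) * g (j + axis k 1) + of_real (p (j $ k - 1)) * g (j - axis k 1)"

lemma ell2_weighted_shift:
  fixes c :: "int ^ 'd \<Rightarrow> real"
  assumes "f \<in> ell2" "\<And>j. 0 < c j" "\<And>j. c j \<le> K"
  shows "(\<lambda>j. of_real (c j) * f (j + a)) \<in> ell2"
  by (rule ell2_dominated[OF ell2_shift[OF assms(1)], of _ K])
    (use assms in \<open>auto simp: norm_mult less_imp_le intro!: mult_right_mono\<close>)

lemma ell2_Lk: "g \<in> ell2 \<Longrightarrow> Lk k g \<in> ell2"
  unfolding Lk_def diff_conv_add_uminus
  by (intro ell2_add ell2_weighted_shift) (auto simp: p_pos q_pos p_le q_le)

lemma ell2_Ak: "g \<in> ell2 \<Longrightarrow> Ak k g \<in> ell2"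
  unfolding Ak_def diff_conv_add_uminus[where b = "axis k 1"]
  by (intro ell2_add ell2_weighted_shift) (auto simp: p_pos q_pos p_le q_le)

lemma Lk_adjoint:
  fixes f g :: "int ^ 'd \<Rightarrow> complex"
  assumes "f \<in> ell2" "g \<in> ell2"
  shows "inner2 f (Lk k g) = inner2 (Ak k f) g"
proof -
  define e :: "int ^ 'd" where "e = axis k 1"
  have e: "e $ k = 1" by (simp add: e_def)
  have s1: "(\<lambda>j. of_real (p (j $ k)) * g (j + e)) \<in> ell2"
    "(\<lambda>j. of_real (q (j $ k)) * g (j + - e)) \<in> ell2"
    by (intro ell2_weighted_shift assms; simp add: p_pos q_pos p_le q_le)+
  define S1 S2 where "S1 = inner2 f (\<lambda>j. of_real (p (j $ k)) * g (j + e))"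
    and "S2 = inner2 f (\<lambda>j. of_real (q (j $ k)) * g (j + - e))"
  have h1: "((\<lambda>j. cnj (f j) * (of_real (p (j $ k)) * g (j + e))) has_sum S1) UNIV"
    and h2: "((\<lambda>j. cnj (f j) * (of_real (q (j $ k)) * g (j + - e))) has_sum S2) UNIV"
    unfolding S1_def S2_def by (intro has_sum_inner2 assms s1)+
  have "((\<lambda>j. cnj (f j) * (of_real (p (j $ k)) * g (j + e)) +
      cnj (f j) * (of_real (q (j $ k)) * g (j + - e))) has_sum (S1 + S2)) UNIV"
    by (rule has_sum_add[OF h1 h2])
  then have "inner2 f (Lk k g) = S1 + S2"
    unfolding inner2_def Lk_def e_def by (intro infsumI) (simp add: distrib_left)
  moreover have "((\<lambda>j. cnj (f (j + - e)) * (of_real (p ((j + - e) $ k)) * g (j + - e + e)) +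
      cnj (f (j + e)) * (of_real (q ((j + e) $ k)) * g (j + e + - e))) has_sum (S1 + S2)) UNIV"
    using has_sum_add[OF iffD2[OF has_sum_shift[where a = "- e"] h1] iffD2[OF has_sum_shift[where a = e] h2]] .
  then have "inner2 (Ak k f) g = S1 + S2"
    unfolding inner2_def Ak_def e_def[symmetric]
    by (intro infsumI) (simp add: e algebra_simps)
  ultimately show ?thesis by simp
qed

lemma Ak_adjoint: "f \<in> ell2 \<Longrightarrow> g \<in> ell2 \<Longrightarrow> inner2 (Lk k f) g = inner2 f (Ak k g)"
  using Lk_adjoint[of g f k] inner2_commute by metis

text \<open>The coefficients in direction \<open>k\<close> depend on coordinate \<open>k\<close>
  only, which a shift in another direction leaves unchanged. This is the source of the cancellation
  between directions.\<close>

lemma Lk_Ak_commute: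
  assumes "k \<noteq> l"
  shows "Ak l (Lk k g) = Lk k (Ak l g)"
  using assms by (intro ext) (simp add: Ak_def Lk_def axis_def algebra_simps)

text \<open>At each site the difference of squares is a quadratic form in the two neighbouring
  values \<open>a\<close> and \<open>b\<close>. Its mixed term has coefficient \<open>- c\<close>
  with \<open>c \<ge> 0\<close>, so it is bounded below using
  \<open>2 * Re (cnj b * a) \<le> |a|\<^sup>2 + |b|\<^sup>2\<close>. Shifting the resulting sums
  back collects, in front of each \<open>|g j|\<^sup>2\<close>, a coefficient that
  \<open>weight_gap_sum\<close> makes nonnegative.\<close>

lemma Ak_norm_le:
  fixes g :: "int ^ 'd \<Rightarrow> complex"
  assumes g: "g \<in> ell2"
  shows "Re (inner2 (Ak k g) (Ak k g)) \<le> Re (inner2 (Lk k g) (Lk k g))"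
proof -
  define e :: "int ^ 'd" where "e = axis k 1"
  have e: "e $ k = 1" by (simp add: e_def)
  define c where "c m = weight_gap v m" for m
  define \<alpha> \<beta> where "\<alpha> m = (p m)\<^sup>2 - (q (m + 1))\<^sup>2 - c m" and "\<beta> m = (q m)\<^sup>2 - (p (m - 1))\<^sup>2 - c m" for m
  have c_eq: "c m = p (m - 1) * q (m + 1) - p m * q m" for m
    unfolding c_def weight_gap_def p_def q_def using v_pos[of m] v_pos[of "m+1"] v_pos[of "m-1"]
    by (simp add: power2_eq_square)
  have K0: "K \<ge> 0" using K_pos by simp
  have pq2: "(p m)\<^sup>2 \<le> K\<^sup>2" "(q m)\<^sup>2 \<le> K\<^sup>2" for m
    by (intro power_mono p_le q_le less_imp_le p_pos q_pos)+
  have c_bd: "\<bar>c m\<bar> \<le> K\<^sup>2" for m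
  proof -
    have "p (m - 1) * q (m + 1) \<le> K * K"
      by (intro mult_mono p_le q_le less_imp_le p_pos q_pos K0)
    moreover have "p m * q m \<ge> 0" by (intro mult_nonneg_nonneg less_imp_le p_pos q_pos)
    ultimately show ?thesis
      using weight_gap_nonneg[of m] c_eq[of m] by (simp add: c_def power2_eq_square)
  qed
  have bd: "\<bar>\<alpha> m\<bar> \<le> 3 * K\<^sup>2" "\<bar>\<beta> m\<bar> \<le> 3 * K\<^sup>2" for m
    unfolding \<alpha>_def \<beta>_def using pq2[of m] pq2[of "m+1"] pq2[of "m-1"] c_bd[of m]
      zero_le_power2[of "p m"] zero_le_power2[of "q m"] zero_le_power2[of "q (m + 1)"] zero_le_power2[of "p (m - 1)"]
    by linarith+
  have summ: "(\<lambda>j. h (j $ k) * (cmod (g j))\<^sup>2) summable_on UNIV" if "\<And>m. \<bar>h m\<bar> \<le> 3 * K\<^sup>2" for h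
  proof (rule abs_summable_summable, rule summable_on_comparison_test)
    show "(\<lambda>j. 3 * K\<^sup>2 * (cmod (g j))\<^sup>2) summable_on UNIV"
      by (intro summable_on_cmult_right ell2_summable g)
    show "norm (h (j $ k) * (cmod (g j))\<^sup>2) \<le> 3 * K\<^sup>2 * (cmod (g j))\<^sup>2" for j
      using that[of "j $ k"] by (auto simp: abs_mult intro!: mult_right_mono)
  qed auto
  define S1 S2 where "S1 = (\<Sum>\<^sub>\<infinity>j. \<alpha> (j $ k - 1) * (cmod (g j))\<^sup>2)"
    and "S2 = (\<Sum>\<^sub>\<infinity>j. \<beta> (j $ k + 1) * (cmod (g j))\<^sup>2)"
  have h1: "((\<lambda>j. \<alpha> (j $ k - 1) * (cmod (g j))\<^sup>2) has_sum S1) UNIV"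
    and h2: "((\<lambda>j. \<beta> (j $ k + 1) * (cmod (g j))\<^sup>2) has_sum S2) UNIV"
    unfolding S1_def S2_def by (intro has_sum_infsum summ bd)+
  have "S1 + S2 \<ge> 0"
  proof (rule has_sum_nonneg[OF has_sum_add[OF h1 h2]])
    fix j
    have "0 \<le> \<alpha> (j $ k - 1) + \<beta> (j $ k + 1)"
      using weight_gap_sum[of "j $ k"] unfolding \<alpha>_def \<beta>_def c_def p_def q_def by simp
    then have "0 \<le> (\<alpha> (j $ k - 1) + \<beta> (j $ k + 1)) * (cmod (g j))\<^sup>2" by simp
    then show "0 \<le> \<alpha> (j $ k - 1) * (cmod (g j))\<^sup>2 + \<beta> (j $ k + 1) * (cmod (g j))\<^sup>2"
      by (simp add: distrib_right)
  qed
  also have "S1 + S2 \<le> Re (inner2 (Lk k g) (Lk k g)) - Re (inner2 (Ak k g) (Ak k g))"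
  proof (rule has_sum_mono)
    have "((\<lambda>j. \<alpha> ((j + e) $ k - 1) * (cmod (g (j + e)))\<^sup>2 + \<beta> ((j + - e) $ k + 1) * (cmod (g (j + - e)))\<^sup>2)
        has_sum S1 + S2) UNIV"
      by (rule has_sum_add[OF iffD2[OF has_sum_shift[where a = e] h1] iffD2[OF has_sum_shift[where a = "- e"] h2]])
    then show "((\<lambda>j. \<alpha> (j $ k) * (cmod (g (j + e)))\<^sup>2 + \<beta> (j $ k) * (cmod (g (j - e)))\<^sup>2) has_sum S1 + S2) UNIV"
      by (simp add: e)
    show "((\<lambda>j. (cmod (Lk k g j))\<^sup>2 - (cmod (Ak k g j))\<^sup>2) has_sum
        Re (inner2 (Lk k g) (Lk k g)) - Re (inner2 (Ak k g) (Ak k g))) UNIV"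
      by (intro has_sum_diff has_sum_norm2 ell2_Lk ell2_Ak g)
  next
    fix j :: "int ^ 'd"
    define m a b where "m = j $ k" and "a = g (j + e)" and "b = g (j - e)"
    have sq: "(cmod (of_real r * a + of_real s * b))\<^sup>2
        = r\<^sup>2 * (cmod a)\<^sup>2 + s\<^sup>2 * (cmod b)\<^sup>2 + r * s * (2 * Re (cnj b * a))" for r s
      unfolding cmod_power2 by (simp add: power2_eq_square algebra_simps)
    have "2 * Re (cnj b * a) \<le> (cmod a)\<^sup>2 + (cmod b)\<^sup>2"
      unfolding cmod_power2
      using zero_le_power2[of "Re a - Re b"] zero_le_power2[of "Im a - Im b"]
      by (simp add: power2_eq_square algebra_simps)
    then have "c m * (2 * Re (cnj b * a)) \<le> c m * ((cmod a)\<^sup>2 + (cmod b)\<^sup>2)"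
      using weight_gap_nonneg[of m] by (intro mult_left_mono) (simp_all add: c_def)
    moreover have "c m * (2 * Re (cnj b * a))
        = p (m - 1) * q (m + 1) * (2 * Re (cnj b * a)) - p m * q m * (2 * Re (cnj b * a))"
      unfolding c_eq by (simp only: left_diff_distrib)
    ultimately have "\<alpha> m * (cmod a)\<^sup>2 + \<beta> m * (cmod b)\<^sup>2
        \<le> (cmod (of_real (p m) * a + of_real (q m) * b))\<^sup>2
          - (cmod (of_real (q (m + 1)) * a + of_real (p (m - 1)) * b))\<^sup>2"
      unfolding sq \<alpha>_def \<beta>_def by (simp add: algebra_simps)
    then show "\<alpha> (j $ k) * (cmod (g (j + e)))\<^sup>2 + \<beta> (j $ k) * (cmod (g (j - e)))\<^sup>2
        \<le> (cmod (Lk k g j))\<^sup>2 - (cmod (Ak k g j))\<^sup>2"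
      by (simp add: Lk_def Ak_def m_def a_def b_def e_def)
  qed
  finally show ?thesis by simp
qed

definition L :: "(int ^ 'd \<Rightarrow> complex) \<Rightarrow> int ^ 'd \<Rightarrow> complex" where
  "L g j = (\<Sum>k\<in>UNIV. Lk k g j)"

definition A :: "(int ^ 'd \<Rightarrow> complex) \<Rightarrow> int ^ 'd \<Rightarrow> complex" where
  "A g j = (\<Sum>k\<in>UNIV. Ak k g j)"

lemma ell2_L: "g \<in> ell2 \<Longrightarrow> L g \<in> ell2" and ell2_A: "g \<in> ell2 \<Longrightarrow> A g \<in> ell2"
  unfolding L_def A_def by (intro ell2_sum ell2_Lk ell2_Ak; simp)+

lemma L_adjoint: "f \<in> ell2 \<Longrightarrow> g \<in> ell2 \<Longrightarrow> inner2 f (L g) = inner2 (A f) g"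
  unfolding L_def A_def
  by (simp add: inner2_sum_left inner2_sum_right ell2_Lk ell2_Ak Lk_adjoint)

text \<open>Expand both sides as double sums over directions. Adjointness and commutation identify
  the off-diagonal terms, and \<open>Ak_norm_le\<close> compares the diagonal ones.\<close>

lemma hyponormal:
  assumes g: "g \<in> ell2"
  shows "Re (inner2 (A g) (A g)) \<le> Re (inner2 (L g) (L g))"
proof -
  have cross: "inner2 (Lk k g) (Lk l g) = inner2 (Ak l g) (Ak k g)" if "k \<noteq> l" for k l
  proof -
    have "inner2 (Lk k g) (Lk l g) = inner2 (Ak l (Lk k g)) g"
      by (intro Lk_adjoint ell2_Lk g)
    also have "\<dots> = inner2 (Lk k (Ak l g)) g" using that by (simp add: Lk_Ak_commute)
    also have "\<dots> = inner2 (Ak l g) (Ak k g)" by (intro Ak_adjoint ell2_Ak g)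
    finally show ?thesis .
  qed
  have le: "Re (inner2 (Ak l g) (Ak k g)) \<le> Re (inner2 (Lk k g) (Lk l g))" for k l
    by (cases "k = l") (simp_all add: cross Ak_norm_le g)
  have "Re (inner2 (A g) (A g)) = (\<Sum>l\<in>UNIV. \<Sum>k\<in>UNIV. Re (inner2 (Ak l g) (Ak k g)))"
    unfolding A_def by (simp add: inner2_sum_left inner2_sum_right ell2_Ak ell2_sum g)
  also have "\<dots> \<le> (\<Sum>l\<in>UNIV. \<Sum>k\<in>UNIV. Re (inner2 (Lk k g) (Lk l g)))"
    by (intro sum_mono le)
  also have "\<dots> = (\<Sum>k\<in>UNIV. \<Sum>l\<in>UNIV. Re (inner2 (Lk k g) (Lk l g)))"
    by (rule sum.swap)
  also have "\<dots> = Re (inner2 (L g) (L g))"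
    unfolding L_def by (simp add: inner2_sum_left inner2_sum_right ell2_Lk ell2_sum g)
  finally show ?thesis .
qed

text \<open>If \<open>g\<close> evolves by \<open>g' = \<i> L g\<close>, the summand below is the second derivative of
  \<open>exp (\<tau> t) |g|\<^sup>2\<close> up to the factor \<open>exp (\<tau> t)\<close>. The sum dominates the squared norm of
  \<open>L g - A g - \<i> \<tau> g\<close>.\<close>

lemma second_derivative_nonneg:
  assumes g: "g \<in> ell2"
    and S: "((\<lambda>j. 2 * (cmod (L g j))\<^sup>2 - 2 * Re (cnj (g j) * L (L g) j)
      - 4 * \<tau> * Im (cnj (g j) * L g j) + \<tau>\<^sup>2 * (cmod (g j))\<^sup>2) has_sum S) UNIV"
  shows "S \<ge> 0"
proof -
  define D where "D j = L g j - A g j - \<i> * of_real \<tau> * g j" for j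
  note [intro] = g ell2_L ell2_A
  have "((\<lambda>j. 2 * (cmod (L g j))\<^sup>2 - 2 * Re (cnj (g j) * L (L g) j)
      - 4 * \<tau> * Im (cnj (g j) * L g j) + \<tau>\<^sup>2 * (cmod (g j))\<^sup>2) has_sum
      (2 * Re (inner2 (L g) (L g)) - 2 * Re (inner2 g (L (L g))) - 4 * \<tau> * Im (inner2 g (L g))
        + \<tau>\<^sup>2 * Re (inner2 g g))) UNIV"
    by (intro has_sum_add has_sum_diff has_sum_cmult_right has_sum_norm2 has_sum_Re has_sum_Im
        has_sum_inner2) auto
  note has_sum_unique[OF S this]
  also have "inner2 g (L (L g)) = inner2 (A g) (L g)"
    by (intro L_adjoint g ell2_L)
  finally have S_eq: "S = 2 * Re (inner2 (L g) (L g)) - 2 * Re (inner2 (A g) (L g)) - 4 * \<tau> * Im (inner2 g (L g))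
        + \<tau>\<^sup>2 * Re (inner2 g g)"
    .
  \<comment> \<open>This splits the term linear in \<open>\<tau>\<close> evenly between
    \<open>L\<close> and \<open>A\<close>, which gives it the shape of the mixed terms in the square
    of \<open>D\<close>.\<close>
  have "inner2 g (L g) = cnj (inner2 g (A g))"
    using L_adjoint[OF g g] inner2_commute[of "A g" g] by simp
  then have Im_eq: "2 * Im (inner2 g (L g)) = Im (inner2 g (L g)) - Im (inner2 g (A g))"
    by simp
  have sum: "((\<lambda>j. (cmod (L g j))\<^sup>2 + (cmod (A g j))\<^sup>2 - 2 * Re (cnj (A g j) * L g j)
      - 2 * \<tau> * (Im (cnj (g j) * L g j) - Im (cnj (g j) * A g j)) + \<tau>\<^sup>2 * (cmod (g j))\<^sup>2) has_sum
      (Re (inner2 (L g) (L g)) + Re (inner2 (A g) (A g)) - 2 * Re (inner2 (A g) (L g))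
        - 2 * \<tau> * (Im (inner2 g (L g)) - Im (inner2 g (A g))) + \<tau>\<^sup>2 * Re (inner2 g g))) UNIV"
    by (intro has_sum_add has_sum_diff has_sum_cmult_right has_sum_norm2 has_sum_Re has_sum_Im
        has_sum_inner2) auto
  have square: "(cmod (L g j))\<^sup>2 + (cmod (A g j))\<^sup>2 - 2 * Re (cnj (A g j) * L g j)
      - 2 * \<tau> * (Im (cnj (g j) * L g j) - Im (cnj (g j) * A g j)) + \<tau>\<^sup>2 * (cmod (g j))\<^sup>2
      = (cmod (D j))\<^sup>2" for j
    unfolding D_def cmod_power2 by (simp add: power2_eq_square algebra_simps)
  have "0 \<le> Re (inner2 (L g) (L g)) + Re (inner2 (A g) (A g)) - 2 * Re (inner2 (A g) (L g))
        - 2 * \<tau> * (Im (inner2 g (L g)) - Im (inner2 g (A g))) + \<tau>\<^sup>2 * Re (inner2 g g)"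
    by (rule has_sum_nonneg[OF sum[unfolded square]]) simp
  also have "\<dots> \<le> S"
    unfolding S_eq Im_eq[symmetric] using hyponormal[OF g] by simp
  finally show ?thesis .
qed

end

section \<open>Decay of solutions\<close>

text \<open>The family is transported to a series over the naturals by \<open>to_nat\<close>, with
  value 0 outside its range, and the Weierstrass test then allows termwise differentiation.\<close>

lemma DERIV_infsum:
  fixes f f' :: "'a :: countable \<Rightarrow> real \<Rightarrow> real"
  assumes S: "convex S" "x \<in> S"
    and der: "\<And>j t. t \<in> S \<Longrightarrow> (f j has_real_derivative f' j t) (at t within S)"
    and bound: "\<And>j t. t \<in> S \<Longrightarrow> \<bar>f' j t\<bar> \<le> M j" "M summable_on UNIV"
    and summ: "\<And>t. t \<in> S \<Longrightarrow> (\<lambda>j. f j t) summable_on UNIV"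
  shows "((\<lambda>t. \<Sum>\<^sub>\<infinity>j. f j t) has_real_derivative (\<Sum>\<^sub>\<infinity>j. f' j x)) (at x within S)"
proof -
  define N where "N h n = (if n \<in> range (to_nat :: 'a \<Rightarrow> nat) then h (from_nat n :: 'a) else 0)"
    for h :: "'a \<Rightarrow> real" and n
  have N_sums: "N h sums infsum h UNIV" if "h summable_on UNIV" for h :: "'a \<Rightarrow> real"
  proof -
    have "((\<lambda>n. h (from_nat n)) has_sum infsum h UNIV) (range (to_nat :: 'a \<Rightarrow> nat))"
      using has_sum_reindex[of "to_nat :: 'a \<Rightarrow> nat" UNIV "\<lambda>n. h (from_nat n)"] that
      by (simp add: o_def)
    also have "?this \<longleftrightarrow> (N h has_sum infsum h UNIV) UNIV"
      by (rule has_sum_cong_neutral) (auto simp: N_def)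
    finally show ?thesis by (rule has_sum_imp_sums)
  qed
  have summ': "(\<lambda>j. f' j t) summable_on UNIV" if "t \<in> S" for t
    by (rule abs_summable_summable, rule summable_on_comparison_test[OF bound(2)])
      (simp_all add: bound(1)[OF that])
  have "\<exists>g. \<forall>t\<in>S. (\<lambda>n. N (\<lambda>j. f j t) n) sums g t \<and>
      (g has_field_derivative (\<Sum>n. N (\<lambda>j. f' j t) n)) (at t within S)"
  proof (rule has_field_derivative_series[OF S(1) _ _ S(2)])
    show "((\<lambda>t. N (\<lambda>j. f j t) n) has_field_derivative N (\<lambda>j. f' j t) n) (at t within S)"
      if "t \<in> S" for n t
      using der[OF that] by (simp add: N_def)
    show "uniform_limit S (\<lambda>n t. \<Sum>i<n. N (\<lambda>j. f' j t) i) (\<lambda>t. \<Sum>n. N (\<lambda>j. f' j t) n) sequentially"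
      by (rule Weierstrass_m_test[OF _ sums_summable[OF N_sums[OF bound(2)]]])
        (simp add: N_def bound(1))
    show "summable (\<lambda>n. N (\<lambda>j. f j x) n)"
      using N_sums[OF summ[OF S(2)]] by (rule sums_summable)
  qed
  then obtain g where g: "\<And>t. t \<in> S \<Longrightarrow> N (\<lambda>j. f j t) sums g t"
    "\<And>t. t \<in> S \<Longrightarrow> (g has_real_derivative (\<Sum>n. N (\<lambda>j. f' j t) n)) (at t within S)" by blast
  have "(\<Sum>\<^sub>\<infinity>j. f j t) = g t" if "t \<in> S" for t
    using N_sums[OF summ[OF that]] g(1)[OF that] by (rule sums_unique2)
  moreover have "(\<Sum>n. N (\<lambda>j. f' j x) n) = (\<Sum>\<^sub>\<infinity>j. f' j x)"
    using N_sums[OF summ'[OF S(2)]] by (simp add: sums_iff)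
  ultimately show ?thesis
    using has_field_derivative_transform_within[OF g(2)[OF S(2)] zero_less_one S(2)] by simp
qed

text \<open>The mean value theorem on both sides of the intermediate point gives two slopes, ordered
  because \<open>f'\<close> is monotone. Derivatives within the interval suffice, which suits
  one-sided derivatives at its ends.\<close>

lemma chord_inequality:
  fixes f f' f'' :: "real \<Rightarrow> real"
  assumes f: "\<And>t. t \<in> {a..b} \<Longrightarrow> (f has_real_derivative f' t) (at t within {a..b})"
    and f': "\<And>t. t \<in> {a..b} \<Longrightarrow> (f' has_real_derivative f'' t) (at t within {a..b})"
    and f'': "\<And>t. t \<in> {a..b} \<Longrightarrow> 0 \<le> f'' t"
    and xy: "x \<in> {a..b}" "y \<in> {a..b}" and s: "0 < s" "s < 1"
  shows "f ((1 - s) * x + s * y) \<le> (1 - s) * f x + s * f y"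
proof -
  have mvt: "\<exists>z. c < z \<and> z < d \<and> h d - h c = (d - c) * h' z"
    if h: "\<And>t. t \<in> {a..b} \<Longrightarrow> (h has_real_derivative h' t) (at t within {a..b})"
      and cd: "a \<le> c" "c < d" "d \<le> b" for h h' :: "real \<Rightarrow> real" and c d
  proof -
    have "continuous_on {a..b} h"
      using h by (meson DERIV_continuous continuous_on_eq_continuous_within)
    then have "continuous_on {c..d} h" by (rule continuous_on_subset) (use cd in auto)
    moreover have "(h has_derivative (\<lambda>v. v * h' t)) (at t)" if "c < t" "t < d" for t
    proof -
      have "at t within {a..b} = at t" using that cd by (intro at_within_Icc_at) auto
      then show ?thesis using h[of t] that cd by (simp add: has_field_derivative_def mult_commute_abs)
    qed
    ultimately show ?thesis using mvt[OF cd(2), of h "\<lambda>t v. v * h' t"] by auto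
  qed
  have mono: "f' c \<le> f' d" if cd: "a \<le> c" "c \<le> d" "d \<le> b" for c d
  proof (cases "c = d")
    case False
    then obtain z where z: "c < z" "z < d" "f' d - f' c = (d - c) * f'' z"
      using mvt[OF f', of c d] cd by auto
    then have "(d - c) * f'' z \<ge> 0" using f''[of z] cd by (intro mult_nonneg_nonneg) auto
    then show ?thesis using z by simp
  qed simp
  have main: "f ((1 - s) * x + s * y) \<le> (1 - s) * f x + s * f y"
    if xy: "x \<in> {a..b}" "y \<in> {a..b}" "x < y" and s: "0 < s" "s < 1" for x y s
  proof -
    define m where "m = (1 - s) * x + s * y"
    have mx: "m - x = s * (y - x)" by (simp add: m_def algebra_simps)
    have my: "y - m = (1 - s) * (y - x)" by (simp add: m_def algebra_simps)
    have "0 < m - x" "0 < y - m" unfolding mx my using xy s by auto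
    then have m: "x < m" "m < y" by auto
    obtain z where z: "x < z" "z < m" "f m - f x = (m - x) * f' z"
      using mvt[OF f, of x m] m xy by auto
    obtain w where w: "m < w" "w < y" "f y - f m = (y - m) * f' w"
      using mvt[OF f, of m y] m xy by auto
    have "f' z \<le> f' w" using z w xy by (intro mono) auto
    then have "(1 - s) * s * (y - x) * f' z \<le> (1 - s) * s * (y - x) * f' w"
      using s xy by (intro mult_left_mono mult_nonneg_nonneg) auto
    then have "(1 - s) * (f m - f x) \<le> s * (f y - f m)"
      unfolding z(3) w(3) mx my by (simp add: algebra_simps)
    then show ?thesis unfolding m_def[symmetric] by (simp add: algebra_simps)
  qed
  consider "x < y" | "y < x" | "x = y" by linarith
  then show ?thesis
  proof cases
    case 1
    then show ?thesis using main xy s by blast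
  next
    case 2
    then show ?thesis using main[of y x "1 - s"] xy s by (simp add: add.commute)
  next
    case 3
    then show ?thesis by (simp add: algebra_simps)
  qed
qed

section \<open>Exponential decay on the lattice\<close>

definition norm1 :: "int ^ 'd \<Rightarrow> real" where
  "norm1 j = (\<Sum>k\<in>UNIV. \<bar>real_of_int (j $ k)\<bar>)"

lemma norm1_nonneg: "norm1 j \<ge> 0"
  unfolding norm1_def by (intro sum_nonneg) auto

lemma norm1_triangle: "norm1 (i + j) \<le> norm1 i + norm1 j"
  unfolding norm1_def sum.distrib[symmetric] by (intro sum_mono) simp

lemma norm1_minus: "norm1 (- j) = norm1 j"
  by (simp add: norm1_def)

lemma norm1_axis:
  fixes k :: "'d :: finite"
  shows "norm1 (axis k 1) = 1"
proof -
  have "norm1 (axis k 1 :: int ^ 'd) = (\<Sum>l\<in>UNIV. if l = k then 1 else 0)"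
    unfolding norm1_def by (intro sum.cong) (auto simp: axis_def)
  then show ?thesis by simp
qed

lemma norm1_neighbour:
  "norm1 (j + axis k 1) \<le> norm1 j + 1" "norm1 (j - axis k 1) \<le> norm1 j + 1"
  "norm1 j \<le> norm1 (j + axis k 1) + 1" "norm1 j \<le> norm1 (j - axis k 1) + 1"
  using norm1_triangle[of j "axis k 1"] norm1_triangle[of j "- axis k 1"]
    norm1_triangle[of "j + axis k 1" "- axis k 1"] norm1_triangle[of "j - axis k 1" "axis k 1"]
  by (simp_all add: norm1_minus norm1_axis)

lemma coordinate_bound:
  fixes F :: "(int ^ 'd) set"
  assumes "finite F"
  shows "\<exists>n. \<forall>j\<in>F. \<forall>k. \<bar>j $ k\<bar> \<le> int n"
proof -
  define M where "M = Max (insert 0 ((\<lambda>(j, k). \<bar>j $ k\<bar>) ` (F \<times> UNIV)))"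
  have "\<bar>j $ k\<bar> \<le> M" if "j \<in> F" for j k
    unfolding M_def using assms that by (intro Max_ge) force+
  moreover have "0 \<le> M" unfolding M_def using assms by (intro Max_ge) auto
  ultimately show ?thesis by (intro exI[of _ "nat M"]) simp
qed

text \<open>A finite set of sites lies in a cube, over which the exponential of the 1-norm factors
  into one-dimensional geometric sums bounded independently of the cube.\<close>

lemma exp_norm1_summable: "(\<lambda>j :: int ^ 'd. exp (- norm1 j)) summable_on UNIV"
proof (rule nonneg_bdd_above_summable_on)
  define c where "c = (\<lambda>m :: int. exp (- \<bar>real_of_int m\<bar>))"
  have geometric: "(\<Sum>m = - int n..int n. c m) \<le> 2 / (1 - exp (-1))" for n
  proof -
    \<comment> \<open>The interval is covered by its nonnegative and nonpositive halves. Counting 0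
      twice makes the bound twice a geometric series.\<close>
    have "(\<Sum>m = - int n..int n. c m) \<le> (\<Sum>m\<in>int ` {..n} \<union> (\<lambda>i. - int i) ` {..n}. c m)"
    proof (rule sum_mono2)
      show "{- int n..int n} \<subseteq> int ` {..n} \<union> (\<lambda>i. - int i) ` {..n}"
      proof
        fix m assume "m \<in> {- int n..int n}"
        then show "m \<in> int ` {..n} \<union> (\<lambda>i. - int i) ` {..n}"
          by (cases m rule: int_cases2) auto
      qed
    qed (auto simp: c_def)
    also have "\<dots> \<le> (\<Sum>m\<in>int ` {..n}. c m) + (\<Sum>m\<in>(\<lambda>i. - int i) ` {..n}. c m)"
      by (subst sum_Un) (auto intro!: sum_nonneg simp: c_def)
    also have "\<dots> = 2 * (\<Sum>i\<le>n. exp (-1) ^ i)"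
      by (simp add: sum.reindex inj_on_def c_def exp_of_nat_mult[symmetric])
    also have "(\<Sum>i\<le>n. exp (-1 :: real) ^ i) \<le> (\<Sum>i. exp (-1) ^ i)"
      by (intro sum_le_suminf summable_geometric) auto
    also have "\<dots> = 1 / (1 - exp (-1))" by (intro suminf_geometric) auto
    finally show ?thesis by simp
  qed
  have "(\<Sum>j\<in>F. exp (- norm1 j)) \<le> (2 / (1 - exp (-1))) ^ CARD('d)"
    if F: "finite F" for F :: "(int ^ 'd) set"
  proof -
    obtain n where n: "\<And>j k. j \<in> F \<Longrightarrow> \<bar>j $ k\<bar> \<le> int n"
      using coordinate_bound[OF F] by blast
    have "(\<Sum>j\<in>F. exp (- norm1 j)) = (\<Sum>j\<in>F. \<Prod>k\<in>UNIV. c (j $ k))"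
      by (simp add: norm1_def c_def exp_sum[symmetric] sum_negf)
    also have "\<dots> = (\<Sum>h\<in>vec_nth ` F. \<Prod>k\<in>UNIV. c (h k))"
      by (subst sum.reindex) (auto simp: inj_on_def vec_nth_inject)
    also have "\<dots> \<le> (\<Sum>h\<in>(\<Pi>\<^sub>E k\<in>(UNIV :: 'd set). {- int n..int n}). \<Prod>k\<in>UNIV. c (h k))"
    proof (rule sum_mono2)
      show "vec_nth ` F \<subseteq> (\<Pi>\<^sub>E k\<in>(UNIV :: 'd set). {- int n..int n})"
        using n by (auto simp: abs_le_iff minus_le_iff)
    qed (auto intro!: finite_PiE prod_nonneg simp: c_def)
    also have "\<dots> = (\<Prod>k\<in>(UNIV :: 'd set). \<Sum>m\<in>{- int n..int n}. c m)"
      by (subst prod_sum_PiE) auto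
    also have "\<dots> \<le> (\<Prod>k\<in>(UNIV :: 'd set). 2 / (1 - exp (-1)))"
      by (intro prod_mono conjI sum_nonneg geometric) (auto simp: c_def)
    finally show ?thesis by simp
  qed
  then show "bdd_above (sum (\<lambda>j :: int ^ 'd. exp (- norm1 j)) ` {F. F \<subseteq> UNIV \<and> finite F})"
    by (intro bdd_aboveI[where M = "(2 / (1 - exp (-1))) ^ CARD('d)"]) auto
qed auto

text \<open>Continuity in the square-sum norm gives a bound near every time, and bisection of the
  compact time interval makes it uniform.\<close>

lemma solution_bounded:
  assumes "free_schroedinger_solution u"
  shows "\<exists>U. \<forall>t\<in>{0..1}. \<forall>j. cmod (u t j) \<le> U"
proof -
  have ell2: "u t \<in> ell2" if "t \<in> {0..1}" for t
    using assms that by (auto simp: free_schroedinger_solution_def ell2_continuous_on_def)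
  have cont: "((\<lambda>s. ell2_norm (\<lambda>j. u s j - u t j)) \<longlongrightarrow> 0) (at t within {0..1})" if "t \<in> {0..1}" for t
    using assms that by (auto simp: free_schroedinger_solution_def ell2_continuous_on_def)
  define P where "P a b \<longleftrightarrow> (\<exists>U. \<forall>t\<in>{a..b} \<inter> {0..1}. \<forall>j. cmod (u t j) \<le> U)" for a b
  have "P 0 1"
  proof (rule Bolzano)
    fix a b c assume "P a b" "P b c"
    then obtain U1 U2 where U: "\<forall>t\<in>{a..b} \<inter> {0..1}. \<forall>j. cmod (u t j) \<le> U1"
      "\<forall>t\<in>{b..c} \<inter> {0..1}. \<forall>j. cmod (u t j) \<le> U2" by (auto simp: P_def)
    have "cmod (u t j) \<le> max U1 U2" if "t \<in> {a..c} \<inter> {0..1}" for t j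
      using U that by (cases "t \<le> b") (auto intro: max.coboundedI1 max.coboundedI2)
    then show "P a c" unfolding P_def by blast
  next
    fix x :: real assume "0 \<le> x" "x \<le> 1"
    then have x: "x \<in> {0..1}" by simp
    have "\<forall>\<^sub>F s in at x within {0..1}. ell2_norm (\<lambda>j. u s j - u x j) < 1"
      using cont[OF x] by (rule order_tendstoD) simp
    then obtain d where d: "d > 0"
      "\<And>s. s \<in> {0..1} \<Longrightarrow> s \<noteq> x \<Longrightarrow> dist s x < d \<Longrightarrow> ell2_norm (\<lambda>j. u s j - u x j) < 1"
      by (auto simp: eventually_at)
    have bd: "cmod (u s j) \<le> ell2_norm (u x) + 1" if "s \<in> {0..1}" "\<bar>s - x\<bar> < d" for s j
    proof (cases "s = x")
      case True
      then show ?thesis using norm_le_ell2_norm[OF ell2[OF x], of j] by simp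
    next
      case False
      have "cmod (u s j - u x j) \<le> ell2_norm (\<lambda>j. u s j - u x j)"
        by (rule norm_le_ell2_norm[OF ell2_diff[OF ell2[OF that(1)] ell2[OF x]]])
      also have "\<dots> < 1" using d(2) that False by (simp add: dist_real_def)
      finally show ?thesis
        using norm_le_ell2_norm[OF ell2[OF x], of j] norm_triangle_ineq2[of "u s j" "u x j"] by linarith
    qed
    show "\<exists>d>0. \<forall>a b. a \<le> x \<and> x \<le> b \<and> b - a < d \<longrightarrow> P a b"
    proof (intro exI[of _ d] conjI allI impI)
      fix a b assume ab: "a \<le> x \<and> x \<le> b \<and> b - a < d"
      have "\<forall>t\<in>{a..b} \<inter> {0..1}. \<forall>j. cmod (u t j) \<le> ell2_norm (u x) + 1"
      proof (intro ballI allI bd)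
        fix t assume "t \<in> {a..b} \<inter> {0..1}"
        then show "t \<in> {0..1}" "\<bar>t - x\<bar> < d" using ab by auto
      qed
      then show "P a b" unfolding P_def by blast
    qed (rule d(1))
  qed simp
  then show ?thesis by (simp add: P_def)
qed

text \<open>The weight is cut off at height \<open>exp R\<close> to make the supremum \<open>N\<close> finite a priori; the factor
  \<open>exp (- 2 \<kappa> t)\<close> makes the integrated equation a contraction, so the bound on \<open>N\<close> is independent
  of \<open>R\<close>.\<close>

lemma exponential_decay_persists:
  fixes u :: "real \<Rightarrow> int ^ 'd \<Rightarrow> complex"
  assumes sol: "free_schroedinger_solution u" and "B \<ge> 0"
    and init: "\<And>j. cmod (u 0 j) \<le> M0 * exp (- B * norm1 j)"
  shows "\<exists>M. \<forall>t\<in>{0..1}. \<forall>j. cmod (u t j) \<le> M * exp (- B * norm1 j)"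
proof -
  obtain U where U: "\<And>t j. t \<in> {0..1} \<Longrightarrow> cmod (u t j) \<le> U"
    using solution_bounded[OF sol] by blast
  have der: "((\<lambda>s. u s j) has_vector_derivative \<i> * discrete_laplacian (u t) j) (at t within {0..1})"
    if "t \<in> {0..1}" for t j
    using sol that by (simp add: free_schroedinger_solution_def)
  \<comment> \<open>The norm of the Laplacian relative to the weight \<open>W\<close>: per
    direction, two neighbours at cost \<open>exp B\<close> each and the centre with coefficient
    2.\<close>
  define \<kappa> where "\<kappa> = real CARD('d) * (2 * exp B + 2)"
  have \<kappa>: "\<kappa> > 0" by (simp add: \<kappa>_def add_pos_pos)
  have M0: "M0 \<ge> 0"
    using order_trans[OF norm_ge_zero init[of 0]] by (simp add: zero_le_mult_iff)
  have key: "exp (min (B * norm1 j) R) * cmod (u t j) \<le> 2 * M0 * exp (2 * \<kappa>)"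
    if t: "t \<in> {0..1}" for R t j
  proof -
    define W where "W j = exp (min (B * norm1 j) R)" for j :: "int ^ 'd"
    have W_pos: "W j > 0" for j by (simp add: W_def)
    have W_nb: "W j \<le> exp B * W (j + axis k 1)" "W j \<le> exp B * W (j - axis k 1)" for j k
    proof -
      have le: "min (B * norm1 j) R \<le> B + min (B * norm1 i) R" if "norm1 j \<le> norm1 i + 1" for i
        using mult_left_mono[OF that \<open>B \<ge> 0\<close>] \<open>B \<ge> 0\<close> by (auto simp: distrib_left min_def)
      show "W j \<le> exp B * W (j + axis k 1)" "W j \<le> exp B * W (j - axis k 1)"
        unfolding W_def exp_add[symmetric] exp_le_cancel_iff
        by (intro le norm1_neighbour)+
    qed
    define X where "X = (\<lambda>(t, j). exp (- 2 * \<kappa> * t) * (W j * cmod (u t j))) ` ({0..1} \<times> UNIV)"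
    define N where "N = Sup X"
    have bdd: "bdd_above X"
    proof (rule bdd_aboveI)
      fix y assume "y \<in> X"
      then obtain t j where tj: "t \<in> {0..1}" "y = exp (- 2 * \<kappa> * t) * (W j * cmod (u t j))"
        by (auto simp: X_def)
      have "exp (- 2 * \<kappa> * t) * (W j * cmod (u t j)) \<le> 1 * (exp R * U)"
        using tj(1) \<kappa> U[OF tj(1)] by (intro mult_mono) (auto simp: W_def)
      then show "y \<le> 1 * (exp R * U)" using tj by simp
    qed
    have N_ge: "exp (- 2 * \<kappa> * t) * (W j * cmod (u t j)) \<le> N" if "t \<in> {0..1}" for t j
      unfolding N_def using that by (intro cSup_upper bdd) (auto simp: X_def)
    have N0: "N \<ge> 0" using N_ge[of 0 j] W_pos[of j] by (smt (verit) atLeastAtMost_iff mult_nonneg_nonneg exp_ge_zero norm_ge_zero)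
    have Wu: "W j * cmod (u t j) \<le> N * exp (2 * \<kappa> * t)" if "t \<in> {0..1}" for t j
      using N_ge[OF that, of j] by (simp add: exp_minus field_simps)
    have lap: "W j * cmod (discrete_laplacian (u t) j) \<le> \<kappa> * (N * exp (2 * \<kappa> * t))" if t: "t \<in> {0..1}" for t j
    proof -
      define Z where "Z = N * exp (2 * \<kappa> * t)"
      have "cmod (discrete_laplacian (u t) j)
          \<le> (\<Sum>k\<in>UNIV. cmod (u t (j + axis k 1)) + 2 * cmod (u t j) + cmod (u t (j - axis k 1)))"
        unfolding discrete_laplacian_def
      proof (intro sum_norm_le)
        fix k
        show "cmod (u t (j + axis k 1) - 2 * u t j + u t (j - axis k 1))
            \<le> cmod (u t (j + axis k 1)) + 2 * cmod (u t j) + cmod (u t (j - axis k 1))"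
          using norm_triangle_ineq[of "u t (j + axis k 1) - 2 * u t j" "u t (j - axis k 1)"]
            norm_triangle_ineq4[of "u t (j + axis k 1)" "2 * u t j"] by (simp add: norm_mult)
      qed
      then have "W j * cmod (discrete_laplacian (u t) j)
          \<le> W j * (\<Sum>k\<in>UNIV. cmod (u t (j + axis k 1)) + 2 * cmod (u t j) + cmod (u t (j - axis k 1)))"
        using W_pos[of j] by (intro mult_left_mono) auto
      also have "\<dots> = (\<Sum>k\<in>UNIV. W j * cmod (u t (j + axis k 1)) + 2 * (W j * cmod (u t j))
          + W j * cmod (u t (j - axis k 1)))"
        unfolding sum_distrib_left by (intro sum.cong) (auto simp: algebra_simps)
      also have "\<dots> \<le> (\<Sum>k\<in>(UNIV :: 'd set). exp B * Z + 2 * Z + exp B * Z)"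
      proof (intro sum_mono add_mono mult_left_mono)
        fix k
        have nb: "W j * cmod (u t i) \<le> exp B * Z" if "W j \<le> exp B * W i" for i
        proof -
          have "W j * cmod (u t i) \<le> exp B * W i * cmod (u t i)"
            using that by (intro mult_right_mono) auto
          also have "\<dots> \<le> exp B * Z"
            unfolding Z_def using Wu[OF t, of i] by (simp add: mult.assoc)
          finally show ?thesis .
        qed
        show "W j * cmod (u t (j + axis k 1)) \<le> exp B * Z" "W j * cmod (u t (j - axis k 1)) \<le> exp B * Z"
          by (intro nb W_nb)+
        show "W j * cmod (u t j) \<le> Z" unfolding Z_def by (rule Wu[OF t])
      qed auto
      also have "\<dots> = \<kappa> * Z" by (simp add: \<kappa>_def algebra_simps)
      finally show ?thesis by (simp add: Z_def)
    qed
    have "exp (- 2 * \<kappa> * t) * (W j * cmod (u t j)) \<le> M0 + N / 2" if t: "t \<in> {0..1}" for t j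
    proof -
      have W0: "W j * cmod (u 0 j) \<le> M0"
      proof -
        have "W j * cmod (u 0 j) \<le> exp (B * norm1 j) * (M0 * exp (- B * norm1 j))"
          by (intro mult_mono init) (auto simp: W_def)
        then show ?thesis by (simp add: exp_minus field_simps)
      qed
      \<comment> \<open>The bound \<open>\<kappa> * N * exp (2 * \<kappa> * s)\<close> on the
        derivative is integrated from 0 to \<open>t\<close>; the 2 in the exponent produces the
        factor 1/2 that makes the estimate a contraction.\<close>
      have diff: "W j * cmod (u t j - u 0 j) \<le> N / 2 * (exp (2 * \<kappa> * t) - 1)"
      proof (cases "t = 0")
        case False
        then have t0: "0 < t" "t \<le> 1" using t by auto
        define \<phi> where "\<phi> s = N / (2 * W j) * exp (2 * \<kappa> * s)" for s
        have "norm (u t j - u 0 j) \<le> \<phi> t - \<phi> 0"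
        proof (rule differentiable_bound_general[OF t0(1)])
          have "continuous_on {0..1} (\<lambda>s. u s j)"
            using der by (meson continuous_on_vector_derivative)
          then show "continuous_on {0..t} (\<lambda>s. u s j)"
            by (rule continuous_on_subset) (use t0 in auto)
          show "continuous_on {0..t} \<phi>" unfolding \<phi>_def by (intro continuous_intros)
          fix s assume s: "0 < s" "s < t"
          have "at s within {0..1} = at s" using s t0 by (intro at_within_Icc_at) auto
          then show "((\<lambda>s. u s j) has_vector_derivative \<i> * discrete_laplacian (u s) j) (at s)"
            using der[of s j] s t0 by simp
          show "(\<phi> has_vector_derivative N / (2 * W j) * (exp (2 * \<kappa> * s) * (2 * \<kappa>))) (at s)"
            unfolding \<phi>_def has_real_derivative_iff_has_vector_derivative[symmetric]
            using W_pos[of j] by (auto intro!: derivative_eq_intros)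
          show "norm (\<i> * discrete_laplacian (u s) j) \<le> N / (2 * W j) * (exp (2 * \<kappa> * s) * (2 * \<kappa>))"
            using lap[of s j] s t0 W_pos[of j] by (simp add: norm_mult field_simps)
        qed
        then have "W j * norm (u t j - u 0 j) \<le> W j * (\<phi> t - \<phi> 0)"
          using W_pos[of j] by (intro mult_left_mono) auto
        also have "\<dots> = N / 2 * (exp (2 * \<kappa> * t) - 1)"
          using W_pos[of j] by (simp add: \<phi>_def field_simps)
        finally show ?thesis .
      qed simp
      have "cmod (u t j) \<le> cmod (u 0 j) + cmod (u t j - u 0 j)"
        using norm_triangle_ineq2[of "u t j" "u 0 j"] by simp
      then have "W j * cmod (u t j) \<le> W j * cmod (u 0 j) + W j * cmod (u t j - u 0 j)"
        unfolding distrib_left[symmetric] using W_pos[of j] by (intro mult_left_mono) auto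
      also have "\<dots> \<le> M0 * exp (2 * \<kappa> * t) + N / 2 * exp (2 * \<kappa> * t)"
      proof -
        have "M0 * 1 \<le> M0 * exp (2 * \<kappa> * t)" using M0 \<kappa> t by (intro mult_left_mono) auto
        moreover have "N / 2 * (exp (2 * \<kappa> * t) - 1) \<le> N / 2 * exp (2 * \<kappa> * t)"
          using N0 by (intro mult_left_mono) auto
        ultimately show ?thesis using W0 diff by linarith
      qed
      finally have "W j * cmod (u t j) \<le> (M0 + N / 2) * exp (2 * \<kappa> * t)" by (simp add: algebra_simps)
      then show ?thesis by (simp add: exp_minus field_simps)
    qed
    \<comment> \<open>\<open>N\<close> is the supremum of the bounded set \<open>X\<close>, so
      \<open>N / 2\<close> can be absorbed on the left.\<close>
    then have "N \<le> M0 + N / 2"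
      unfolding N_def by (intro cSup_least) (auto simp: X_def N_def)
    then have N2: "N \<le> 2 * M0" by simp
    have "W j * cmod (u t j) \<le> N * exp (2 * \<kappa> * t)" by (rule Wu[OF t])
    also have "\<dots> \<le> 2 * M0 * exp (2 * \<kappa>)"
      using N2 N0 M0 \<kappa> t by (intro mult_mono) auto
    finally show ?thesis by (simp add: W_def)
  qed
  \<comment> \<open>The cutoff is chosen equal to the exponent at the site \<open>j\<close>, where
    it then has no effect.\<close>
  have "cmod (u t j) \<le> 2 * M0 * exp (2 * \<kappa>) * exp (- B * norm1 j)" if "t \<in> {0..1}" for t j
    using key[OF that, of j "B * norm1 j"] by (simp add: exp_minus field_simps)
  then show ?thesis by blast
qed

section \<open>Convexity of weighted norms\<close>

context admissible_weight
begin

definition V :: "int ^ 'd \<Rightarrow> real" where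
  "V j = (\<Prod>k\<in>UNIV. v (j $ k))"

lemma V_pos: "V j > 0"
  unfolding V_def by (intro prod_pos) (simp add: v_pos)

lemma V_update:
  assumes "i $ k = m" and "\<And>l. l \<noteq> k \<Longrightarrow> i $ l = j $ l"
  shows "V j = v (j $ k) / v m * V i"
proof -
  have "V j = v (j $ k) * (\<Prod>l\<in>UNIV - {k}. v (j $ l))"
    unfolding V_def by (subst prod.remove[of _ k]) auto
  moreover have "V i = v m * (\<Prod>l\<in>UNIV - {k}. v (j $ l))"
    unfolding V_def using assms by (subst prod.remove[of _ k]) (auto intro!: prod.cong)
  ultimately show ?thesis using v_pos[of m] by simp
qed

lemma V_neighbour:
  "V j = p (j $ k) * V (j + axis k 1)" "V j = q (j $ k) * V (j - axis k 1)"
  unfolding p_def q_def by (rule V_update; simp add: axis_def)+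

lemma v_le: "v m \<le> v 0 * max K 1 ^ nat \<bar>m\<bar>"
proof -
  have up: "v (int n) \<le> v 0 * max K 1 ^ n" and down: "v (- int n) \<le> v 0 * max K 1 ^ n" for n
  proof (induction n)
    case (Suc n)
    { case 1
      have "v (int (Suc n)) \<le> K * v (int n)" using v_Suc_le[of "int n"] by (simp add: add.commute)
      also have "\<dots> \<le> max K 1 * (v 0 * max K 1 ^ n)"
        using Suc(1) v_pos[of "int n"] by (intro mult_mono) (auto simp: less_imp_le)
      finally show ?case by (simp add: mult.left_commute) }
    { case 2
      have "v (- int (Suc n)) \<le> K * v (- int n)" using v_le_Suc[of "- int (Suc n)"] by simp
      also have "\<dots> \<le> max K 1 * (v 0 * max K 1 ^ n)"
        using Suc(2) v_pos[of "- int n"] by (intro mult_mono) (auto simp: less_imp_le)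
      finally show ?case by (simp add: mult.left_commute) }
  qed simp_all
  show ?thesis
    using up[of "nat \<bar>m\<bar>"] down[of "nat \<bar>m\<bar>"] by (cases "m \<ge> 0") simp_all
qed

lemma V_le: "V (j :: int ^ 'd) \<le> v 0 ^ CARD('d) * exp (ln (max K 1) * norm1 j)"
proof -
  have "V j \<le> (\<Prod>k\<in>UNIV. v 0 * exp (ln (max K 1) * \<bar>real_of_int (j $ k)\<bar>))"
    unfolding V_def
  proof (intro prod_mono conjI)
    fix k
    have "max K 1 ^ nat \<bar>j $ k\<bar> = exp (ln (max K 1) * \<bar>real_of_int (j $ k)\<bar>)"
      by (simp add: powr_realpow[symmetric] powr_def mult.commute)
    then show "v (j $ k) \<le> v 0 * exp (ln (max K 1) * \<bar>real_of_int (j $ k)\<bar>)"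
      using v_le[of "j $ k"] by simp
  qed (simp add: v_pos less_imp_le)
  also have "\<dots> = v 0 ^ CARD('d) * exp (ln (max K 1) * norm1 j)"
    by (simp add: prod.distrib exp_sum[symmetric] norm1_def sum_distrib_left)
  finally show ?thesis .
qed

lemma L_linear: "L (\<lambda>j. a * (f j - b * g j)) j = a * (L f j - b * L g j)"
proof -
  have "Lk k (\<lambda>j. a * (f j - b * g j)) j = a * (Lk k f j - b * Lk k g j)" for k
    by (simp add: Lk_def algebra_simps)
  then show ?thesis
    by (simp add: L_def sum_distrib_left[symmetric] sum_subtractf)
qed

text \<open>Moving to a neighbour changes \<open>norm1\<close> by at most 1 and so costs a factor
  \<open>exp 1\<close>. Applied twice, this dominates \<open>L g\<close> and \<open>L (L g)\<close>
  by a fixed summable family.\<close>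

lemma L_bound:
  fixes f :: "int ^ 'd \<Rightarrow> complex"
  assumes "\<And>j. cmod (f j) \<le> N * exp (- norm1 j)"
  shows "cmod (L f j) \<le> real CARD('d) * (2 * K * exp 1) * N * exp (- norm1 j)"
proof -
  have N: "N \<ge> 0"
    using order_trans[OF norm_ge_zero assms[of 0]] by (simp add: zero_le_mult_iff)
  have nb: "cmod (of_real c * f i) \<le> K * exp 1 * N * exp (- norm1 j)"
    if "0 < c" "c \<le> K" "norm1 j \<le> norm1 i + 1" for c i
  proof -
    have "cmod (of_real c * f i) \<le> K * (N * exp (1 - norm1 j))"
      unfolding norm_mult using that N
      by (intro mult_mono order_trans[OF assms] mult_left_mono) auto
    also have "\<dots> = K * exp 1 * N * exp (- norm1 j)" by (simp add: exp_diff exp_minus field_simps)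
    finally show ?thesis .
  qed
  have "cmod (L f j) \<le> (\<Sum>k\<in>(UNIV :: 'd set). K * exp 1 * N * exp (- norm1 j) + K * exp 1 * N * exp (- norm1 j))"
    unfolding L_def Lk_def
    by (intro sum_norm_le order_trans[OF norm_triangle_ineq] add_mono nb p_pos q_pos p_le q_le norm1_neighbour)
  then show ?thesis by (simp add: algebra_simps)
qed

lemma ell2_exp_bound:
  fixes f :: "int ^ 'd \<Rightarrow> complex"
  assumes "\<And>j. cmod (f j) \<le> N * exp (- norm1 j)"
  shows "f \<in> ell2"
  unfolding ell2_def mem_Collect_eq
proof (rule summable_on_comparison_test)
  show "(\<lambda>j :: int ^ 'd. N\<^sup>2 * exp (- norm1 j)) summable_on UNIV"
    by (intro summable_on_cmult_right exp_norm1_summable)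
  show "(cmod (f j))\<^sup>2 \<le> N\<^sup>2 * exp (- norm1 j)" for j
  proof -
    have "(cmod (f j))\<^sup>2 \<le> N\<^sup>2 * (exp (- norm1 j))\<^sup>2"
      using power_mono[OF assms, of j 2] by (simp add: power_mult_distrib)
    also have "\<dots> \<le> N\<^sup>2 * exp (- norm1 j)"
      using norm1_nonneg[of j] by (intro mult_left_mono) (auto simp: power2_eq_square mult_le_one)
    finally show ?thesis .
  qed
qed auto

text \<open>The family \<open>g = V u\<close> satisfies \<open>g' = \<i> (L g - 2 d g)\<close> with
  \<open>d\<close> the dimension. Decay of \<open>u\<close> dominates \<open>g\<close>,
  \<open>L g\<close> and \<open>L (L g)\<close> uniformly in time, so
  \<open>exp (\<tau> t) |g|\<^sup>2\<close> may be differentiated twice termwise. Its second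
  derivative is nonnegative by \<open>second_derivative_nonneg\<close>, and
  \<open>chord_inequality\<close> applies.\<close>

lemma weighted_norm_chord:
  fixes u :: "real \<Rightarrow> int ^ 'd \<Rightarrow> complex"
  assumes sol: "free_schroedinger_solution u"
    and decay: "\<And>B. B \<ge> 0 \<Longrightarrow> \<exists>M. \<forall>t\<in>{0..1}. \<forall>j. cmod (u t j) \<le> M * exp (- B * norm1 j)"
    and xy: "x \<in> {0..1}" "y \<in> {0..1}" and s: "0 < s" "s < 1"
  defines "F \<equiv> \<lambda>t. \<Sum>\<^sub>\<infinity>j. (V j)\<^sup>2 * (cmod (u t j))\<^sup>2"
  defines "m \<equiv> (1 - s) * x + s * y"
  shows "exp (\<tau> * m) * F m \<le> (1 - s) * (exp (\<tau> * x) * F x) + s * (exp (\<tau> * y) * F y)"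
    and "t \<in> {0..1} \<Longrightarrow> (\<lambda>j. (V j)\<^sup>2 * (cmod (u t j))\<^sup>2) summable_on UNIV"
proof -
  define g where "g t j = of_real (V j) * u t j" for t j
  define g' where "g' t j = \<i> * (L (g t) j - 2 * real CARD('d) * g t j)" for t j
  define b where "b j = exp (- norm1 j)" for j :: "int ^ 'd"
  have b: "0 < b j" "b j \<le> 1" for j by (auto simp: b_def norm1_nonneg)
  \<comment> \<open>The logarithm offsets the growth of \<open>V\<close> from \<open>V_le\<close>;
    the additional 1 leaves the summable factor \<open>exp (- norm1 j)\<close>.\<close>
  obtain M where M: "\<And>t j. t \<in> {0..1} \<Longrightarrow> cmod (u t j) \<le> M * exp (- (ln (max K 1) + 1) * norm1 j)"
  proof -
    have "ln (max K 1) + 1 \<ge> 0" by simp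
    from decay[OF this] show ?thesis using that by blast
  qed
  define N where "N = v 0 ^ CARD('d) * M"
  have gN: "cmod (g t j) \<le> N * b j" if "t \<in> {0..1}" for t j
  proof -
    have "cmod (g t j) \<le> (v 0 ^ CARD('d) * exp (ln (max K 1) * norm1 j)) * (M * exp (- (ln (max K 1) + 1) * norm1 j))"
      unfolding g_def norm_mult using V_pos[of j] V_le[of j] M[OF that, of j] v_pos[of 0]
      by (intro mult_mono) auto
    also have "\<dots> = N * b j"
    proof -
      have "exp (ln (max K 1) * norm1 j) * exp (- (ln (max K 1) + 1) * norm1 j) = b j"
        unfolding b_def exp_add[symmetric] by (simp add: algebra_simps)
      then show ?thesis by (simp add: N_def mult.assoc mult.left_commute)
    qed
    finally show ?thesis .
  qed
  have N0: "N \<ge> 0"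
    using order_trans[OF norm_ge_zero gN[OF xy(1), of 0]] b[of 0] by (simp add: zero_le_mult_iff)
  define \<kappa> where "\<kappa> = real CARD('d) * (2 * K * exp 1)"
  have \<kappa>0: "\<kappa> \<ge> 0" using K_pos by (simp add: \<kappa>_def)
  have LN: "cmod (L (g t) j) \<le> \<kappa> * N * b j" if "t \<in> {0..1}" for t j
    using L_bound[of "g t" N j] gN[OF that] by (simp add: \<kappa>_def b_def)
  have LLN: "cmod (L (L (g t)) j) \<le> \<kappa> * (\<kappa> * N) * b j" if "t \<in> {0..1}" for t j
    using L_bound[of "L (g t)" "\<kappa> * N" j] LN[OF that] by (simp add: \<kappa>_def b_def)
  have g_ell2: "g t \<in> ell2" if "t \<in> {0..1}" for t
    using gN[OF that] unfolding b_def by (rule ell2_exp_bound)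
  have dg: "((\<lambda>t. g t j) has_vector_derivative g' t j) (at t within {0..1})" if "t \<in> {0..1}" for t j
  proof -
    have "((\<lambda>s. u s j) has_vector_derivative \<i> * discrete_laplacian (u t) j) (at t within {0..1})"
      using sol that by (simp add: free_schroedinger_solution_def)
    from has_vector_derivative_mult_right[OF this, of "of_real (V j)"]
    have "((\<lambda>t. g t j) has_vector_derivative of_real (V j) * (\<i> * discrete_laplacian (u t) j)) (at t within {0..1})"
      unfolding g_def .
    also have "of_real (V j) * (\<i> * discrete_laplacian (u t) j) = g' t j"
    proof -
      have "of_real (V j) * discrete_laplacian (u t) j = (\<Sum>k\<in>UNIV. Lk k (g t) j - 2 * g t j)"
        unfolding discrete_laplacian_def sum_distrib_left
      proof (intro sum.cong refl)
        fix k
        have up: "complex_of_real (V j) = of_real (p (j $ k)) * of_real (V (j + axis k 1))"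
          and down: "complex_of_real (V j) = of_real (q (j $ k)) * of_real (V (j - axis k 1))"
          by (simp_all only: of_real_mult[symmetric] V_neighbour[symmetric])
        have "of_real (V j) * u t (j + axis k 1) = of_real (p (j $ k)) * g t (j + axis k 1)"
          "of_real (V j) * u t (j - axis k 1) = of_real (q (j $ k)) * g t (j - axis k 1)"
          unfolding g_def by (simp only: up mult.assoc, simp only: down mult.assoc)
        then have "Lk k (g t) j = of_real (V j) * u t (j + axis k 1) + of_real (V j) * u t (j - axis k 1)"
          by (simp only: Lk_def)
        then show "of_real (V j) * (u t (j + axis k 1) - 2 * u t j + u t (j - axis k 1)) = Lk k (g t) j - 2 * g t j"
          by (simp add: g_def algebra_simps)
      qed
      then show ?thesis by (simp add: g'_def L_def sum_subtractf mult.left_commute)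
    qed
    finally show ?thesis .
  qed
  have dL: "((\<lambda>t. L (g t) j) has_vector_derivative L (g' t) j) (at t within {0..1})" if "t \<in> {0..1}" for t j
    unfolding L_def Lk_def
    by (intro has_vector_derivative_sum has_vector_derivative_add has_vector_derivative_mult_right dg that)
  have Lg': "L (g' t) j = \<i> * (L (L (g t)) j - 2 * real CARD('d) * L (g t) j)" for t j
    unfolding g'_def[abs_def] by (rule L_linear)
  \<comment> \<open>\<open>P'\<close> and \<open>P''\<close> are the first two derivatives of
    \<open>P\<close>. The diagonal part \<open>- 2 d g\<close> of the equation is a pure phase and
    cancels in both, so it does not appear.\<close>
  define P P' P'' where "P j t = (cmod (g t j))\<^sup>2" and "P' j t = - 2 * Im (cnj (g t j) * L (g t) j)"
    and "P'' j t = 2 * (cmod (L (g t) j))\<^sup>2 - 2 * Re (cnj (g t j) * L (L (g t)) j)" for j t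
  have dP: "(P j has_real_derivative P' j t) (at t within {0..1})" if t: "t \<in> {0..1}" for j t
  proof -
    have "((\<lambda>t. Re (cnj (g t j) * g t j)) has_vector_derivative
        Re (cnj (g t j) * g' t j + cnj (g' t j) * g t j)) (at t within {0..1})"
      by (intro bounded_linear.has_vector_derivative[OF bounded_linear_Re] has_vector_derivative_mult
          has_vector_derivative_cnj dg t)
    moreover have "(\<lambda>t. Re (cnj (g t j) * g t j)) = P j"
      unfolding P_def cmod_power2 by (simp add: power2_eq_square)
    moreover have "Re (cnj (g t j) * g' t j + cnj (g' t j) * g t j) = P' j t"
      unfolding P'_def g'_def by (simp add: algebra_simps)
    ultimately show ?thesis by (simp add: has_real_derivative_iff_has_vector_derivative)
  qed
  have dP': "(P' j has_real_derivative P'' j t) (at t within {0..1})" if t: "t \<in> {0..1}" for j t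
  proof -
    have "((\<lambda>t. Im (cnj (g t j) * L (g t) j)) has_vector_derivative
        Im (cnj (g t j) * L (g' t) j + cnj (g' t j) * L (g t) j)) (at t within {0..1})"
      by (intro bounded_linear.has_vector_derivative[OF bounded_linear_Im] has_vector_derivative_mult
          has_vector_derivative_cnj dg dL t)
    then have "((\<lambda>t. Im (cnj (g t j) * L (g t) j)) has_real_derivative
        Im (cnj (g t j) * L (g' t) j + cnj (g' t j) * L (g t) j)) (at t within {0..1})"
      by (simp add: has_real_derivative_iff_has_vector_derivative)
    from DERIV_cmult[OF this, of "- 2"]
    have "(P' j has_real_derivative - 2 * Im (cnj (g t j) * L (g' t) j + cnj (g' t j) * L (g t) j)) (at t within {0..1})"
      unfolding P'_def .
    also have "- 2 * Im (cnj (g t j) * L (g' t) j + cnj (g' t j) * L (g t) j) = P'' j t"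
      unfolding P''_def Lg' g'_def cmod_power2 by (simp add: power2_eq_square algebra_simps)
    finally show ?thesis .
  qed
  define h h' h'' where "h j t = exp (\<tau> * t) * P j t" and "h' j t = exp (\<tau> * t) * (P' j t + \<tau> * P j t)"
    and "h'' j t = exp (\<tau> * t) * (P'' j t + 2 * \<tau> * P' j t + \<tau>\<^sup>2 * P j t)" for j t
  have dh: "(h j has_real_derivative h' j t) (at t within {0..1})" if "t \<in> {0..1}" for j t
    unfolding h_def h'_def
    by (rule derivative_eq_intros dP that refl)+ (simp add: algebra_simps)
  have dh': "(h' j has_real_derivative h'' j t) (at t within {0..1})" if "t \<in> {0..1}" for j t
    unfolding h'_def h''_def
    by (rule derivative_eq_intros dP dP' that refl)+ (simp add: algebra_simps power2_eq_square)
  have prod_bound: "a * c \<le> X * Y * b j" if "a \<le> X * b j" "c \<le> Y * b j" "0 \<le> a" "0 \<le> c" "0 \<le> X" for a c X Y j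
  proof -
    have "a * c \<le> (X * b j) * (Y * b j)" using that b[of j] by (intro mult_mono) auto
    also have "\<dots> = (X * (Y * b j)) * b j" by simp
    also have "\<dots> \<le> (X * (Y * b j)) * 1"
      using b[of j] mult_nonneg_nonneg[OF \<open>0 \<le> X\<close> order_trans[OF that(4,2)]]
      by (intro mult_left_mono) auto
    finally show ?thesis by simp
  qed
  have P_le: "\<bar>P j t\<bar> \<le> N * N * b j" if "t \<in> {0..1}" for j t
    unfolding P_def power2_eq_square using gN[OF that, of j] N0 by (simp add: prod_bound)
  have P'_le: "\<bar>P' j t\<bar> \<le> 2 * (N * (\<kappa> * N) * b j)" if "t \<in> {0..1}" for j t
  proof -
    have "\<bar>Im (cnj (g t j) * L (g t) j)\<bar> \<le> cmod (g t j) * cmod (L (g t) j)"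
      using abs_Im_le_cmod[of "cnj (g t j) * L (g t) j"] by (simp add: norm_mult)
    also have "\<dots> \<le> N * (\<kappa> * N) * b j"
      by (intro prod_bound gN LN that N0) auto
    finally show ?thesis by (simp add: P'_def)
  qed
  have P''_le: "\<bar>P'' j t\<bar> \<le> 2 * ((\<kappa> * N) * (\<kappa> * N) * b j) + 2 * (N * (\<kappa> * (\<kappa> * N)) * b j)" if "t \<in> {0..1}" for j t
  proof -
    have "\<bar>Re (cnj (g t j) * L (L (g t)) j)\<bar> \<le> cmod (g t j) * cmod (L (L (g t)) j)"
      using abs_Re_le_cmod[of "cnj (g t j) * L (L (g t)) j"] by (simp add: norm_mult)
    also have "\<dots> \<le> N * (\<kappa> * (\<kappa> * N)) * b j"
      by (intro prod_bound gN LLN that N0) auto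
    finally have 1: "\<bar>Re (cnj (g t j) * L (L (g t)) j)\<bar> \<le> N * (\<kappa> * (\<kappa> * N)) * b j" .
    have "(cmod (L (g t) j))\<^sup>2 \<le> (\<kappa> * N) * (\<kappa> * N) * b j"
      unfolding power2_eq_square by (intro prod_bound LN that) (auto simp: N0 \<kappa>0)
    moreover have "(cmod (L (g t) j))\<^sup>2 \<ge> 0" by simp
    ultimately show ?thesis using 1 unfolding P''_def by linarith
  qed
  have exp_le: "exp (\<tau> * t) \<le> exp \<bar>\<tau>\<bar>" if "t \<in> {0..1}" for t
  proof -
    have "\<tau> * t \<le> \<bar>\<tau>\<bar> * 1" using that by (intro mult_mono) auto
    then show ?thesis by simp
  qed
  define C1 C2 where "C1 = exp \<bar>\<tau>\<bar> * (2 * (N * (\<kappa> * N)) + \<bar>\<tau>\<bar> * (N * N))"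
    and "C2 = exp \<bar>\<tau>\<bar> * (2 * ((\<kappa> * N) * (\<kappa> * N)) + 2 * (N * (\<kappa> * (\<kappa> * N))) + 2 * \<bar>\<tau>\<bar> * (2 * (N * (\<kappa> * N))) + \<tau>\<^sup>2 * (N * N))"
  have h'_le: "\<bar>h' j t\<bar> \<le> C1 * b j" if t: "t \<in> {0..1}" for j t
  proof -
    have "\<bar>h' j t\<bar> \<le> exp \<bar>\<tau>\<bar> * (2 * (N * (\<kappa> * N) * b j) + \<bar>\<tau>\<bar> * (N * N * b j))"
      unfolding h'_def abs_mult abs_exp_cancel
      by (intro mult_mono exp_le t order_trans[OF abs_triangle_ineq] add_mono P'_le)
        (auto simp: abs_mult intro!: mult_left_mono P_le t)
    then show ?thesis by (simp add: C1_def algebra_simps)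
  qed
  have h''_le: "\<bar>h'' j t\<bar> \<le> C2 * b j" if t: "t \<in> {0..1}" for j t
  proof -
    have "\<bar>2 * \<tau> * P' j t\<bar> \<le> 2 * \<bar>\<tau>\<bar> * (2 * (N * (\<kappa> * N) * b j))"
      unfolding abs_mult using P'_le[OF t, of j] by (intro mult_mono) auto
    moreover have "\<bar>\<tau>\<^sup>2 * P j t\<bar> \<le> \<tau>\<^sup>2 * (N * N * b j)"
      unfolding abs_mult using P_le[OF t, of j] by (intro mult_mono) auto
    ultimately have "\<bar>P'' j t + 2 * \<tau> * P' j t + \<tau>\<^sup>2 * P j t\<bar>
        \<le> 2 * ((\<kappa> * N) * (\<kappa> * N) * b j) + 2 * (N * (\<kappa> * (\<kappa> * N)) * b j)
          + 2 * \<bar>\<tau>\<bar> * (2 * (N * (\<kappa> * N) * b j)) + \<tau>\<^sup>2 * (N * N * b j)"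
      using P''_le[OF t, of j] by linarith
    then have "\<bar>h'' j t\<bar> \<le> exp \<bar>\<tau>\<bar> * (2 * ((\<kappa> * N) * (\<kappa> * N) * b j) + 2 * (N * (\<kappa> * (\<kappa> * N)) * b j)
          + 2 * \<bar>\<tau>\<bar> * (2 * (N * (\<kappa> * N) * b j)) + \<tau>\<^sup>2 * (N * N * b j))"
      unfolding h''_def abs_mult abs_exp_cancel by (intro mult_mono exp_le t) auto
    then show ?thesis by (simp add: C2_def algebra_simps)
  qed
  have b_summ: "(\<lambda>j. c * b j) summable_on UNIV" for c
    unfolding b_def by (intro summable_on_cmult_right exp_norm1_summable)
  have dominated: "f summable_on UNIV" if "\<And>j. \<bar>f j\<bar> \<le> c * b j" for f c
    by (rule abs_summable_summable, rule summable_on_comparison_test[OF b_summ[of c]]) (auto simp: that)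
  have P_summ: "(\<lambda>j. P j t) summable_on UNIV" if "t \<in> {0..1}" for t
    by (rule dominated[OF P_le[OF that]])
  have h_summ: "(\<lambda>j. h j t) summable_on UNIV" if "t \<in> {0..1}" for t
    unfolding h_def by (intro summable_on_cmult_right P_summ that)
  have P_eq: "P j t = (V j)\<^sup>2 * (cmod (u t j))\<^sup>2" for j t
    by (simp add: P_def g_def norm_mult power_mult_distrib)
  show "t \<in> {0..1} \<Longrightarrow> (\<lambda>j. (V j)\<^sup>2 * (cmod (u t j))\<^sup>2) summable_on UNIV"
    using P_summ[of t] by (simp add: P_eq)
  define H H' H'' where "H t = (\<Sum>\<^sub>\<infinity>j. h j t)" and "H' t = (\<Sum>\<^sub>\<infinity>j. h' j t)" and "H'' t = (\<Sum>\<^sub>\<infinity>j. h'' j t)" for t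
  have dH: "(H has_real_derivative H' t) (at t within {0..1})" if "t \<in> {0..1}" for t
    unfolding H_def H'_def
    by (rule DERIV_infsum[where M = "\<lambda>j. C1 * b j"])
      (use that dh h'_le b_summ h_summ in auto)
  have dH': "(H' has_real_derivative H'' t) (at t within {0..1})" if "t \<in> {0..1}" for t
    unfolding H'_def H''_def
    by (rule DERIV_infsum[where M = "\<lambda>j. C2 * b j"])
      (use that dh' h''_le b_summ dominated[OF h'_le] in auto)
  have H''_nonneg: "0 \<le> H'' t" if t: "t \<in> {0..1}" for t
  proof -
    have "((\<lambda>j. exp (- \<tau> * t) * h'' j t) has_sum exp (- \<tau> * t) * H'' t) UNIV"
      unfolding H''_def by (intro has_sum_cmult_right has_sum_infsum dominated[OF h''_le[OF t]])
    moreover have "exp (- \<tau> * t) * h'' j t = 2 * (cmod (L (g t) j))\<^sup>2 - 2 * Re (cnj (g t j) * L (L (g t)) j)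
      - 4 * \<tau> * Im (cnj (g t j) * L (g t) j) + \<tau>\<^sup>2 * (cmod (g t j))\<^sup>2" for j
    proof -
      have "exp (- \<tau> * t) * h'' j t = (exp (- \<tau> * t) * exp (\<tau> * t)) * (P'' j t + 2 * \<tau> * P' j t + \<tau>\<^sup>2 * P j t)"
        by (simp add: h''_def)
      also have "exp (- \<tau> * t) * exp (\<tau> * t) = 1" by (simp add: exp_minus)
      finally show ?thesis by (simp add: P_def P'_def P''_def algebra_simps)
    qed
    ultimately have "0 \<le> exp (- \<tau> * t) * H'' t"
      using second_derivative_nonneg[OF g_ell2[OF t], of \<tau>] by simp
    then show ?thesis by (simp add: zero_le_mult_iff)
  qed
  have "H m \<le> (1 - s) * H x + s * H y"
    unfolding m_def by (rule chord_inequality[OF dH dH' H''_nonneg xy s])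
  moreover have "H t = exp (\<tau> * t) * F t" for t
    unfolding H_def h_def F_def by (simp add: infsum_cmult_right' P_eq)
  ultimately show "exp (\<tau> * m) * F m \<le> (1 - s) * (exp (\<tau> * x) * F x) + s * (exp (\<tau> * y) * F y)"
    by simp
qed

end

section \<open>Bessel weights\<close>

text \<open>The weight is the even extension of the sequence whose successive quotients are
  \<open>z\<close>. On nonnegative indices its gaps are \<open>turan_gap z\<close>, nonnegative
  because \<open>z\<close> is at least 1 and monotone; negative indices follow by
  reflection.\<close>

lemma admissible_weight_of_ratios:
  assumes "c > 0" and gap: "gap_condition z" and K: "\<And>n. z n \<le> K" and z1: "\<And>n. 1 \<le> z n"
    and mono: "\<And>n. z n \<le> z (Suc n)"
  shows "admissible_weight (\<lambda>m. c * (\<Prod>i<nat \<bar>m\<bar>. z i)) K"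
proof -
  define v where "v m = c * (\<Prod>i<nat \<bar>m\<bar>. z i)" for m :: int
  have z_pos: "z n > 0" for n using z1[of n] by linarith
  have v_pos: "v m > 0" for m
    unfolding v_def using \<open>c > 0\<close> by (intro mult_pos_pos prod_pos) (auto simp: z_pos)
  have v_minus: "v (- m) = v m" for m by (simp add: v_def)
  have v_Suc: "v (int (Suc n)) = v (int n) * z n" for n
    by (simp add: v_def nat_add_distrib)
  have v_up: "v (int n) \<le> v (int (Suc n))" for n
    unfolding v_Suc using z1[of n] v_pos[of "int n"] by simp
  have v_down: "v (int (Suc n)) \<le> K * v (int n)" for n
    unfolding v_Suc using K[of n] v_pos[of "int n"] by (simp add: mult.commute)
  have "1 \<le> K" using z1 K order_trans by blast
  then have K1: "v m \<le> K * v m" for m using v_pos[of m] by simp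
  have gap_minus: "weight_gap v (- m) = weight_gap v m" for m
    using v_minus[of "m - 1"] v_minus[of "m + 1"] v_minus[of m]
    by (simp add: weight_gap_def mult.commute)
  have gap_eq: "weight_gap v (int n) = turan_gap z n" for n
  proof (cases n)
    case 0
    have "v 1 = v 0 * z 0" "v (- 1) = v 0 * z 0" using v_Suc[of 0] v_minus[of 1] by simp_all
    then show ?thesis
      using v_pos[of 0] z_pos[of 0] by (simp add: 0 weight_gap_def turan_gap_def power2_eq_square)
  next
    case (Suc k)
    have "v (int n + 1) = v (int k) * z k * z (Suc k)" "v (int n - 1) = v (int k)" "v (int n) = v (int k) * z k"
      using v_Suc[of k] v_Suc[of "Suc k"] by (simp_all add: Suc add.commute)
    then show ?thesis
      using v_pos[of "int k"] z_pos[of k] z_pos[of "Suc k"]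
      by (simp add: Suc weight_gap_def turan_gap_def power2_eq_square)
  qed
  have gap_nonneg: "turan_gap z n \<ge> 0" for n
  proof (cases n)
    case 0
    have "1 \<le> (z 0)\<^sup>2" using z1[of 0] by simp
    then show ?thesis
      using inverse_minus_antimono[of 1 "(z 0)\<^sup>2"] by (simp add: 0 turan_gap_def)
  next
    case (Suc k)
    have "1 \<le> z n / z k" using mono[of k] z_pos[of k] by (simp add: Suc)
    then show ?thesis
      using inverse_minus_antimono[of 1 "z n / z k"] by (simp add: Suc turan_gap_def)
  qed
  have sum: "weight_gap v (int n + 1) + weight_gap v (int n - 1)
      \<le> (v (int n - 1) / v (int n))\<^sup>2 + (v (int n + 1) / v (int n))\<^sup>2
        - (v (int n) / v (int n + 1))\<^sup>2 - (v (int n) / v (int n - 1))\<^sup>2" for n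
  proof (cases n)
    \<comment> \<open>Both neighbours of the origin have the gap \<open>turan_gap z 1\<close> by
      evenness, so the inequality is twice the first part of \<open>gap_condition\<close>.\<close>
    case 0
    have "v 1 = v 0 * z 0" "v (- 1) = v 0 * z 0" using v_Suc[of 0] v_minus[of 1] by simp_all
    moreover have "weight_gap v 1 = turan_gap z 1" "weight_gap v (- 1) = turan_gap z 1"
      using gap_eq[of 1] gap_minus[of 1] by simp_all
    moreover have "turan_gap z 1 \<le> (z 0)\<^sup>2 - 1 / (z 0)\<^sup>2"
      using gap by (simp add: gap_condition_def turan_gap_def[of z 0])
    ultimately show ?thesis
      using v_pos[of 0] z_pos[of 0] by (simp add: 0 power_divide)
  next
    case (Suc k)
    have "v (int n + 1) = v (int k) * z k * z (Suc k)" "v (int n - 1) = v (int k)" "v (int n) = v (int k) * z k"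
      using v_Suc[of k] v_Suc[of "Suc k"] by (simp_all add: Suc add.commute)
    moreover have "weight_gap v (int n + 1) = turan_gap z (Suc (Suc k))" "weight_gap v (int n - 1) = turan_gap z k"
      using gap_eq[of "Suc (Suc k)"] gap_eq[of k] by (simp_all add: Suc add.commute)
    moreover have "turan_gap z (Suc (Suc k)) + turan_gap z k
        \<le> (z (Suc k))\<^sup>2 - 1 / (z (Suc k))\<^sup>2 + 1 / (z k)\<^sup>2 - (z k)\<^sup>2"
      using gap by (simp add: gap_condition_def)
    ultimately show ?thesis
      using v_pos[of "int k"] z_pos[of k] z_pos[of "Suc k"] by (simp add: power_divide)
  qed
  have "admissible_weight v K"
  proof
    fix m :: int
    show "v m > 0" by (rule v_pos)
    show "v (m + 1) \<le> K * v m"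
    proof (cases "m \<ge> 0")
      case True
      then show ?thesis using v_down[of "nat m"] by (simp add: add.commute)
    next
      case False
      then show ?thesis
        using v_up[of "nat (- m - 1)"] v_minus[of "m + 1"] v_minus[of m] K1[of m] by simp
    qed
    show "v m \<le> K * v (m + 1)"
    proof (cases "m \<ge> 0")
      case True
      then show ?thesis using v_up[of "nat m"] K1[of "m + 1"] by (simp add: add.commute)
    next
      case False
      then show ?thesis
        using v_down[of "nat (- m - 1)"] v_minus[of "m + 1"] v_minus[of m] by simp
    qed
    obtain n where n: "m = int n \<or> m = - int n" by (cases m rule: int_cases2) auto
    show "0 \<le> weight_gap v m"
      using n gap_nonneg[of n] by (auto simp: gap_minus gap_eq)
    show "weight_gap v (m + 1) + weight_gap v (m - 1)
      \<le> (v (m - 1) / v m)\<^sup>2 + (v (m + 1) / v m)\<^sup>2 - (v m / v (m + 1))\<^sup>2 - (v m / v (m - 1))\<^sup>2"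
      using n
    proof
      assume m: "m = - int n"
      have "weight_gap v (m + 1) = weight_gap v (int n - 1)" "weight_gap v (m - 1) = weight_gap v (int n + 1)"
        "v (m + 1) = v (int n - 1)" "v (m - 1) = v (int n + 1)" "v m = v (int n)"
        using gap_minus[of "int n - 1"] gap_minus[of "int n + 1"] v_minus[of "int n - 1"]
          v_minus[of "int n + 1"] v_minus[of "int n"] by (simp_all add: m)
      then show ?thesis using sum[of n] by (simp add: algebra_simps)
    qed (simp add: sum)
  qed
  then show ?thesis by (simp add: v_def[abs_def])
qed

lemma bessel_I_prod_ratio:
  assumes "x > 0"
  shows "1 / bessel_I m x = 1 / bessel_I 0 x * (\<Prod>i<nat \<bar>m\<bar>. bessel_ratio x i)"
proof -
  have "1 / bessel_I (int n) x = 1 / bessel_I 0 x * (\<Prod>i<n. bessel_ratio x i)" for n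
  proof (induction n)
    case (Suc n)
    have "1 / bessel_I (int (Suc n)) x = 1 / bessel_I (int n) x * bessel_ratio x n"
      using bessel_I_pos[OF assms, of "int n"] by (simp add: bessel_ratio_def)
    then show ?case using Suc by simp
  qed simp
  then have "1 / bessel_I (int (nat \<bar>m\<bar>)) x = 1 / bessel_I 0 x * (\<Prod>i<nat \<bar>m\<bar>. bessel_ratio x i)" .
  moreover have "bessel_I (int (nat \<bar>m\<bar>)) x = bessel_I m x"
    by (cases "m \<ge> 0") (simp_all add: bessel_I_uminus)
  ultimately show ?thesis by simp
qed

text \<open>The weight is built from truncated ratios with the same value at 0 as the reciprocal
  Bessel weight. Its value at \<open>m\<close> involves only ratios of index below
  \<open>|m|\<close>, hence agrees where these are unchanged; elsewhere the ratios are
  smaller.\<close>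

lemma bessel_truncated_weight:
  assumes "x > 0"
  shows "\<exists>v K. admissible_weight v K \<and> (\<forall>m. v m \<le> 1 / bessel_I m x) \<and>
    (\<forall>m. \<bar>m\<bar> \<le> int n \<longrightarrow> v m = 1 / bessel_I m x)"
proof -
  interpret ratio_sequence "bessel_ratio x" "1 / x"
    by (rule ratio_sequence_bessel[OF assms])
  obtain z K where z: "gap_condition z" "\<And>n. z n \<le> K" "\<And>n. 1 \<le> z n" "\<And>n. z n \<le> z (Suc n)"
    "\<And>n. z n \<le> bessel_ratio x n" "\<And>i. i \<le> n \<Longrightarrow> z i = bessel_ratio x i"
    using truncation[of n] by blast
  have I0: "1 / bessel_I 0 x > 0" using bessel_I_pos[OF assms] by simp
  define v where "v m = 1 / bessel_I 0 x * (\<Prod>i<nat \<bar>m\<bar>. z i)" for m :: int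
  have "admissible_weight v K"
    unfolding v_def by (rule admissible_weight_of_ratios[OF I0 z(1-4)])
  moreover have "v m \<le> 1 / bessel_I m x" for m
    unfolding v_def bessel_I_prod_ratio[OF assms, of m] using I0 z(3,5)
    by (intro mult_left_mono prod_mono) (auto intro: order_trans[OF zero_le_one])
  moreover have "v m = 1 / bessel_I m x" if "\<bar>m\<bar> \<le> int n" for m
    unfolding v_def bessel_I_prod_ratio[OF assms, of m] using that
    by (intro arg_cong2[of _ _ _ _ "(*)"] prod.cong refl z(6)) auto
  ultimately show ?thesis by blast
qed

text \<open>The ratios grow at least linearly, so they eventually exceed \<open>exp B\<close>; from
  there \<open>bessel_I n x * exp (B * n)\<close> is nonincreasing, and finitely many earlier values
  remain.\<close>

lemma bessel_I_exp_bound: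
  assumes "x > 0"
  shows "\<exists>c > 0. \<forall>m. bessel_I m x \<le> c * exp (- B * \<bar>real_of_int m\<bar>)"
proof -
  define a where "a n = bessel_I (int n) x * exp (B * real n)" for n
  obtain N :: nat where N: "x * exp B < real N" using reals_Archimedean2 by blast
  have dec: "a (Suc n) \<le> a n" if "n \<ge> N" for n
  proof -
    have "x * exp B \<le> real n"
      using less_imp_le[OF N] of_nat_mono[OF that, where 'a = real] by (rule order_trans)
    also have "\<dots> \<le> 2 * (real n + 1)" by simp
    finally have "exp B \<le> 2 * (real n + 1) / x" using assms by (simp add: field_simps)
    also have "\<dots> \<le> bessel_ratio x n" by (rule bessel_ratio_ge[OF assms])
    finally have "exp B * bessel_I (int (Suc n)) x \<le> bessel_I (int n) x"
      using bessel_I_pos[OF assms, of "int (Suc n)"] by (simp add: bessel_ratio_def field_simps)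
    then have "exp B * bessel_I (int (Suc n)) x * exp (B * real n) \<le> bessel_I (int n) x * exp (B * real n)"
      by (intro mult_right_mono) auto
    then show ?thesis
      by (simp add: a_def distrib_left exp_add mult_ac)
  qed
  define c where "c = Max (a ` {..N})"
  have a_le: "a n \<le> c" for n
  proof (cases "n \<le> N")
    case True
    then show ?thesis unfolding c_def by (intro Max_ge) auto
  next
    case False
    have "a (N + k) \<le> a N" for k
      by (induction k) (auto intro: order_trans[OF dec])
    then have "a n \<le> a N" using False by (metis le_add_diff_inverse nat_le_linear)
    also have "\<dots> \<le> c" unfolding c_def by (intro Max_ge) auto
    finally show ?thesis .
  qed
  have "0 < a 0" using bessel_I_pos[OF assms] by (simp add: a_def)
  then have c: "c > 0" using a_le[of 0] by linarith
  moreover have "bessel_I m x \<le> c * exp (- B * \<bar>real_of_int m\<bar>)" for m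
  proof -
    have "bessel_I (int (nat \<bar>m\<bar>)) x = bessel_I m x"
      by (cases "m \<ge> 0") (simp_all add: bessel_I_uminus)
    then have "bessel_I m x * exp (B * \<bar>real_of_int m\<bar>) \<le> c"
      using a_le[of "nat \<bar>m\<bar>"] by (simp add: a_def)
    then show ?thesis by (simp add: exp_minus field_simps)
  qed
  ultimately show ?thesis by blast
qed

text \<open>If both values are positive, \<open>\<sigma> = ln F0 - ln F1\<close> makes the two
  exponential terms equal to the weighted geometric mean. If one value is 0, the other term can be
  made arbitrarily small by sending \<open>\<sigma>\<close> to infinity with the right sign, so
  \<open>G \<le> 0\<close>.\<close>

lemma log_convex_bound:
  fixes F0 F1 G :: real
  assumes nonneg: "0 \<le> F0" "0 \<le> F1" and s: "0 < s" "s < 1"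
    and G: "\<And>\<sigma>. G \<le> (1 - s) * (exp (- s * \<sigma>) * F0) + s * (exp ((1 - s) * \<sigma>) * F1)"
  shows "G \<le> F0 powr (1 - s) * F1 powr s"
proof -
  have vanish: "G \<le> 0" if "\<And>\<sigma>. G \<le> a * exp (- r * \<sigma>)" "r > 0" "a \<ge> 0" for a r
  proof (rule ccontr)
    assume "\<not> G \<le> 0"
    then have G0: "G > 0" by simp
    define \<sigma> where "\<sigma> = (ln (a + 1) - ln G) / r"
    have "exp (- r * \<sigma>) = G / (a + 1)"
      using that(2,3) G0 by (simp add: \<sigma>_def exp_diff)
    then have "G \<le> a * (G / (a + 1))" using that(1)[of \<sigma>] by simp
    then show False using G0 that(3) by (simp add: field_simps)
  qed
  consider "F0 = 0" | "F1 = 0" | "F0 > 0" "F1 > 0" using nonneg by linarith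
  then show ?thesis
  proof cases
    case 1
    have "G \<le> s * F1 * exp (- (1 - s) * \<sigma>)" for \<sigma>
      using G[of "- \<sigma>"] 1 by (simp add: algebra_simps)
    then have "G \<le> 0" using s nonneg by (intro vanish[of "s * F1" "1 - s"]) auto
    then show ?thesis by (rule order_trans) simp
  next
    case 2
    have "G \<le> (1 - s) * F0 * exp (- s * \<sigma>)" for \<sigma>
      using G[of \<sigma>] 2 by (simp add: mult_ac)
    then have "G \<le> 0" using s nonneg by (intro vanish[of "(1 - s) * F0" s]) auto
    then show ?thesis by (rule order_trans) simp
  next
    case 3
    define \<sigma> where "\<sigma> = ln F0 - ln F1"
    define R where "R = exp ((1 - s) * ln F0 + s * ln F1)"
    have "exp (- s * \<sigma>) * F0 = exp (- s * \<sigma>) * exp (ln F0)" using 3 by simp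
    also have "\<dots> = R" unfolding R_def exp_add[symmetric] \<sigma>_def by (simp add: algebra_simps)
    finally have 0: "exp (- s * \<sigma>) * F0 = R" .
    have "exp ((1 - s) * \<sigma>) * F1 = exp ((1 - s) * \<sigma>) * exp (ln F1)" using 3 by simp
    also have "\<dots> = R" unfolding R_def exp_add[symmetric] \<sigma>_def by (simp add: algebra_simps)
    finally have 1: "exp ((1 - s) * \<sigma>) * F1 = R" .
    have "G \<le> R" using G[of \<sigma>] unfolding 0 1 by (simp add: algebra_simps)
    also have "R = F0 powr (1 - s) * F1 powr s" using 3 by (simp add: R_def powr_def exp_add)
    finally show ?thesis .
  qed
qed

section \<open>Decay from the weighted data and passage to the full Bessel weight\<close>

lemma bessel_weight_pos: "lam > 0 \<Longrightarrow> C > 0 \<Longrightarrow> bessel_weight C lam j > 0"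
  unfolding bessel_weight_def by (intro mult_pos_pos prod_pos) (auto intro: bessel_I_pos)

lemma bessel_weight_exp_bound:
  assumes "lam > 0" "C > 0"
  shows "\<exists>c \<ge> 0. \<forall>j :: int ^ 'd. bessel_weight C lam j \<le> c * exp (- B * norm1 j)"
proof -
  have x: "1 / (2 * lam) > 0" using assms by simp
  obtain c where c: "c > 0" "\<And>m. bessel_I m (1 / (2 * lam)) \<le> c * exp (- B * \<bar>real_of_int m\<bar>)"
    using bessel_I_exp_bound[OF x, of B] by blast
  have "bessel_weight C lam j \<le> C * c ^ CARD('d) * exp (- B * norm1 j)" for j :: "int ^ 'd"
  proof -
    have "(\<Prod>k\<in>UNIV. bessel_I (j $ k) (1 / (2 * lam))) \<le> (\<Prod>k\<in>UNIV. c * exp (- B * \<bar>real_of_int (j $ k)\<bar>))"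
      by (intro prod_mono conjI c(2) less_imp_le bessel_I_pos x)
    also have "\<dots> = c ^ CARD('d) * exp (- B * norm1 j)"
      by (simp add: prod.distrib exp_sum[symmetric] norm1_def sum_distrib_left sum_negf)
    finally show ?thesis
      unfolding bessel_weight_def using assms(2) by (simp add: mult_left_mono mult.assoc)
  qed
  then show ?thesis using assms c(1) by (intro exI[of _ "C * c ^ CARD('d)"]) auto
qed

text \<open>Each term of the weighted sum at time 0 is bounded by the whole sum, and the weight
  decays faster than any exponential. \<open>exponential_decay_persists\<close> carries this to
  later times.\<close>

lemma solution_decay:
  fixes u :: "real \<Rightarrow> int ^ 'd \<Rightarrow> complex"
  assumes "lam > 0" "C > 0" and sol: "free_schroedinger_solution u"
    and summ: "(\<lambda>j. 1 / (bessel_weight C lam j)\<^sup>2 * (cmod (u 0 j))\<^sup>2) summable_on UNIV"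
    and "B \<ge> 0"
  shows "\<exists>M. \<forall>t\<in>{0..1}. \<forall>j. cmod (u t j) \<le> M * exp (- B * norm1 j)"
proof -
  define S where "S = (\<Sum>\<^sub>\<infinity>j. 1 / (bessel_weight C lam j)\<^sup>2 * (cmod (u 0 j))\<^sup>2)"
  obtain c where c: "c \<ge> 0" "\<And>j :: int ^ 'd. bessel_weight C lam j \<le> c * exp (- B * norm1 j)"
    using bessel_weight_exp_bound[OF assms(1,2)] by blast
  have "cmod (u 0 j) \<le> sqrt S * c * exp (- B * norm1 j)" for j
  proof -
    have w: "bessel_weight C lam j > 0" by (rule bessel_weight_pos[OF assms(1,2)])
    have "(\<Sum>j\<in>{j}. 1 / (bessel_weight C lam j)\<^sup>2 * (cmod (u 0 j))\<^sup>2) \<le> S"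
      unfolding S_def by (intro finite_sum_le_infsum summ) auto
    then have "(cmod (u 0 j) / bessel_weight C lam j)\<^sup>2 \<le> S" by (simp add: power_divide)
    then have "cmod (u 0 j) / bessel_weight C lam j \<le> sqrt S" by (rule real_le_rsqrt)
    then have "cmod (u 0 j) \<le> sqrt S * bessel_weight C lam j" using w by (simp add: field_simps)
    also have "\<dots> \<le> sqrt S * (c * exp (- B * norm1 j))"
    proof (intro mult_left_mono c(2))
      show "0 \<le> sqrt S" unfolding S_def by (intro real_sqrt_ge_zero infsum_nonneg) simp
    qed
    finally show ?thesis by (simp add: mult.assoc)
  qed
  then show ?thesis by (rule exponential_decay_persists[OF sol \<open>B \<ge> 0\<close>])
qed

text \<open>A truncated weight is chosen to agree with the full one on a cube containing
  \<open>A\<close> and to lie below it elsewhere. The left-hand side is then computed exactly on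
  \<open>A\<close>, while replacing the truncated weight by the full one only enlarges the
  right-hand side. Finite sums are used because summability at the intermediate time is not yet
  known.\<close>

lemma weighted_sum_chord:
  fixes u :: "real \<Rightarrow> int ^ 'd \<Rightarrow> complex"
  assumes lam: "lam > 0" and C: "C > 0" and sol: "free_schroedinger_solution u"
    and decay: "\<And>B. B \<ge> 0 \<Longrightarrow> \<exists>M. \<forall>t\<in>{0..1}. \<forall>j. cmod (u t j) \<le> M * exp (- B * norm1 j)"
    and xy: "x \<in> {0..1}" "y \<in> {0..1}" and s: "0 < s" "s < 1"
  defines "\<Phi> \<equiv> \<lambda>t j. 1 / (bessel_weight C lam j)\<^sup>2 * (cmod (u t j))\<^sup>2"
  defines "m \<equiv> (1 - s) * x + s * y"
  assumes summ: "\<Phi> x summable_on UNIV" "\<Phi> y summable_on UNIV" and "finite A"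
  shows "exp (\<tau> * m) * sum (\<Phi> m) A
    \<le> (1 - s) * (exp (\<tau> * x) * infsum (\<Phi> x) UNIV) + s * (exp (\<tau> * y) * infsum (\<Phi> y) UNIV)"
proof -
  define r where "r = 1 / (2 * lam)"
  have r: "r > 0" using lam by (simp add: r_def)
  obtain n where n: "\<And>j k. j \<in> A \<Longrightarrow> \<bar>j $ k\<bar> \<le> int n"
    using coordinate_bound[OF \<open>finite A\<close>] by blast
  obtain v K where v: "admissible_weight v K" "\<And>m. v m \<le> 1 / bessel_I m r"
    "\<And>m. \<bar>m\<bar> \<le> int n \<Longrightarrow> v m = 1 / bessel_I m r"
    using bessel_truncated_weight[OF r, of n] by blast
  interpret admissible_weight v K by (rule v(1))
  have weight_eq: "1 / bessel_weight C lam j = (\<Prod>k\<in>UNIV. 1 / bessel_I (j $ k) r) / C" for j :: "int ^ 'd"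
    by (simp add: bessel_weight_def r_def prod_dividef)
  have V_le: "V j / C \<le> 1 / bessel_weight C lam j" for j :: "int ^ 'd"
    unfolding weight_eq V_def using C v(2) v_pos
    by (intro divide_right_mono prod_mono) (auto intro: less_imp_le)
  have V_eq: "V j / C = 1 / bessel_weight C lam j" if "j \<in> A" for j
    unfolding weight_eq V_def by (intro arg_cong2[of _ _ _ _ "(/)"] prod.cong refl v(3) n that)
  define \<Psi> where "\<Psi> t j = (V j)\<^sup>2 * (cmod (u t j))\<^sup>2" for t j
  have \<Psi>_summ: "\<Psi> t summable_on UNIV" if "t \<in> {0..1}" for t
    using weighted_norm_chord(2)[OF sol decay xy s that] unfolding \<Psi>_def .
  have \<Psi>_le: "\<Psi> t j \<le> C\<^sup>2 * \<Phi> t j" for t j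
  proof -
    have "(V j / C)\<^sup>2 \<le> (1 / bessel_weight C lam j)\<^sup>2"
      using V_le[of j] V_pos[of j] C by (intro power_mono) auto
    then have "(V j)\<^sup>2 \<le> C\<^sup>2 * (1 / (bessel_weight C lam j)\<^sup>2)" using C by (simp add: power_divide field_simps)
    then show ?thesis unfolding \<Psi>_def \<Phi>_def mult.assoc[symmetric] by (intro mult_right_mono) auto
  qed
  have \<Psi>_eq: "\<Psi> t j = C\<^sup>2 * \<Phi> t j" if "j \<in> A" for t j
  proof -
    have "V j = C * (1 / bessel_weight C lam j)" using V_eq[OF that] C by (simp add: field_simps)
    then show ?thesis by (simp add: \<Psi>_def \<Phi>_def power_mult_distrib power_divide)
  qed
  have \<Psi>_infsum: "infsum (\<Psi> t) UNIV \<le> C\<^sup>2 * infsum (\<Phi> t) UNIV"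
    if "t \<in> {0..1}" "\<Phi> t summable_on UNIV" for t
  proof -
    have "infsum (\<Psi> t) UNIV \<le> (\<Sum>\<^sub>\<infinity>j. C\<^sup>2 * \<Phi> t j)"
      by (intro infsum_mono \<Psi>_summ summable_on_cmult_right that \<Psi>_le)
    then show ?thesis by (simp add: infsum_cmult_right')
  qed
  have m: "m \<in> {0..1}"
    unfolding m_def using xy s convex_bound_le[of x 1 y "1 - s" s] by auto
  have "C\<^sup>2 * sum (\<Phi> m) A = sum (\<Psi> m) A"
    by (simp add: sum_distrib_left \<Psi>_eq)
  also have "\<dots> \<le> infsum (\<Psi> m) UNIV"
    using m \<open>finite A\<close> by (intro finite_sum_le_infsum \<Psi>_summ) (auto simp: \<Psi>_def)
  finally have "C\<^sup>2 * (exp (\<tau> * m) * sum (\<Phi> m) A) \<le> exp (\<tau> * m) * infsum (\<Psi> m) UNIV"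
    by (simp add: mult.left_commute)
  also have "\<dots> \<le> (1 - s) * (exp (\<tau> * x) * infsum (\<Psi> x) UNIV) + s * (exp (\<tau> * y) * infsum (\<Psi> y) UNIV)"
    using weighted_norm_chord(1)[OF sol decay xy s, of \<tau>] unfolding \<Psi>_def m_def .
  also have "\<dots> \<le> (1 - s) * (exp (\<tau> * x) * (C\<^sup>2 * infsum (\<Phi> x) UNIV)) + s * (exp (\<tau> * y) * (C\<^sup>2 * infsum (\<Phi> y) UNIV))"
    using s xy summ by (intro add_mono mult_left_mono \<Psi>_infsum) auto
  also have "\<dots> = C\<^sup>2 * ((1 - s) * (exp (\<tau> * x) * infsum (\<Phi> x) UNIV) + s * (exp (\<tau> * y) * infsum (\<Phi> y) UNIV))"
    by (simp add: algebra_simps)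
  finally show ?thesis using C by simp
qed

theorem theorem2p1:
  fixes u :: "real \<Rightarrow> int ^ 'd \<Rightarrow> complex"
    and lam C :: real
  assumes "lam > 0"
    and "C > 0"
    and "free_schroedinger_solution u"
    and "(\<lambda>j. 1 / (bessel_weight C lam j)\<^sup>2 * (cmod (u 0 j))\<^sup>2) summable_on UNIV"
    and "(\<lambda>j. 1 / (bessel_weight C lam j)\<^sup>2 * (cmod (u 1 j))\<^sup>2) summable_on UNIV"
  shows "(\<forall>t\<in>{0..1}. (\<lambda>j. 1 / (bessel_weight C lam j)\<^sup>2 * (cmod (u t j))\<^sup>2) summable_on UNIV) \<and>
    log_convex_on {0..1} (\<lambda>t. \<Sum>\<^sub>\<infinity>j. 1 / (bessel_weight C lam j)\<^sup>2 * (cmod (u t j))\<^sup>2)"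
proof -
  define \<Phi> where "\<Phi> t j = 1 / (bessel_weight C lam j)\<^sup>2 * (cmod (u t j))\<^sup>2" for t j
  note decay = solution_decay[OF assms(1-4)]
  note chord = weighted_sum_chord[OF assms(1-3) decay, folded \<Phi>_def]
  have \<Phi>_nonneg: "\<Phi> t j \<ge> 0" for t j by (simp add: \<Phi>_def)
  have \<Phi>01: "\<Phi> 0 summable_on UNIV" "\<Phi> 1 summable_on UNIV"
    unfolding \<Phi>_def[abs_def] by (fact assms(4), fact assms(5))
  have summ: "\<Phi> t summable_on UNIV" if t: "t \<in> {0..1}" for t
  proof -
    consider "t = 0" | "t = 1" | "0 < t" "t < 1" using t by fastforce
    then show ?thesis
    proof cases
      case 3
      \<comment> \<open>The case \<open>\<tau> = 0\<close> with endpoints 0 and 1 bounds all finite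
        partial sums by one constant.\<close>
      have "sum (\<Phi> t) A \<le> (1 - t) * infsum (\<Phi> 0) UNIV + t * infsum (\<Phi> 1) UNIV" if "finite A" for A
        using chord[of 0 1 t A 0] 3 \<Phi>01 that by simp
      then show ?thesis
        by (intro nonneg_bdd_above_summable_on \<Phi>_nonneg bdd_aboveI[where M = "(1 - t) * infsum (\<Phi> 0) UNIV + t * infsum (\<Phi> 1) UNIV"]) auto
    qed (simp_all add: \<Phi>01)
  qed
  have nonneg: "infsum (\<Phi> t) UNIV \<ge> 0" for t by (intro infsum_nonneg \<Phi>_nonneg)
  have "infsum (\<Phi> ((1 - s) * t0 + s * t1)) UNIV \<le> infsum (\<Phi> t0) UNIV powr (1 - s) * infsum (\<Phi> t1) UNIV powr s"
    if t: "t0 \<in> {0..1}" "t1 \<in> {0..1}" and s: "0 < s" "s < 1" for t0 t1 s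
  proof (cases "t0 = t1")
    case True
    have "(1 - s) * t1 + s * t1 = t1" by (simp add: algebra_simps)
    then show ?thesis
      using True nonneg[of t1] by (simp add: powr_add[symmetric])
  next
    case False
    define m where "m = (1 - s) * t0 + s * t1"
    have m: "m \<in> {0..1}"
      unfolding m_def using t s convex_bound_le[of t0 1 t1 "1 - s" s] by auto
    have "infsum (\<Phi> m) UNIV \<le> infsum (\<Phi> t0) UNIV powr (1 - s) * infsum (\<Phi> t1) UNIV powr s"
    proof (rule log_convex_bound[OF nonneg nonneg s])
      fix \<sigma> :: real
      \<comment> \<open>With this scaling, multiplying the chord inequality by
        \<open>exp (- \<tau> * m)\<close> turns its exponents into \<open>- s * \<sigma>\<close> and
        \<open>(1 - s) * \<sigma>\<close>, the form that \<open>log_convex_bound\<close> asks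
        for.\<close>
      define \<tau> where "\<tau> = \<sigma> / (t1 - t0)"
      have \<tau>: "\<tau> * (t1 - t0) = \<sigma>" using False by (simp add: \<tau>_def)
      have e0: "exp (- (\<tau> * m)) * exp (\<tau> * t0) = exp (- s * \<sigma>)"
        and e1: "exp (- (\<tau> * m)) * exp (\<tau> * t1) = exp ((1 - s) * \<sigma>)"
        unfolding \<tau>[symmetric] exp_add[symmetric] m_def by (simp_all add: algebra_simps)
      show "infsum (\<Phi> m) UNIV \<le> (1 - s) * (exp (- s * \<sigma>) * infsum (\<Phi> t0) UNIV)
          + s * (exp ((1 - s) * \<sigma>) * infsum (\<Phi> t1) UNIV)"
      proof (rule infsum_le_finite_sums[OF summ[OF m]])
        fix A :: "(int ^ 'd) set" assume "finite A"
        have "exp (- (\<tau> * m)) * (exp (\<tau> * m) * sum (\<Phi> m) A)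
          \<le> exp (- (\<tau> * m)) * ((1 - s) * (exp (\<tau> * t0) * infsum (\<Phi> t0) UNIV) + s * (exp (\<tau> * t1) * infsum (\<Phi> t1) UNIV))"
          using chord[OF _ t s summ[OF t(1)] summ[OF t(2)] \<open>finite A\<close>, of \<tau>]
          unfolding m_def by (intro mult_left_mono) auto
        also have "\<dots> = (1 - s) * ((exp (- (\<tau> * m)) * exp (\<tau> * t0)) * infsum (\<Phi> t0) UNIV)
            + s * ((exp (- (\<tau> * m)) * exp (\<tau> * t1)) * infsum (\<Phi> t1) UNIV)"
          by (simp add: algebra_simps)
        also have "exp (- (\<tau> * m)) * (exp (\<tau> * m) * sum (\<Phi> m) A) = sum (\<Phi> m) A"
          by (simp add: exp_minus)
        finally show "sum (\<Phi> m) A \<le> (1 - s) * (exp (- s * \<sigma>) * infsum (\<Phi> t0) UNIV)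
            + s * (exp ((1 - s) * \<sigma>) * infsum (\<Phi> t1) UNIV)"
          unfolding e0 e1 .
      qed
    qed
    then show ?thesis by (simp add: m_def)
  qed
  then show ?thesis
    using summ nonneg unfolding log_convex_on_def \<Phi>_def[abs_def] by auto
qed

end
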